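(* Let $n\ge 1$, $\delta\in(0,n]$, $\alpha\in(0,\delta)$, $\kappa\in[0,\alpha)$ and $p\in(\delta/n,\delta/\alpha)$. Then there exists a constant $c$, depending only on $n$, $\delta$, $\alpha$, $\kappa$ and $p$, such that for all Lebesgue measurable functions $f:\mathbb{R}^n\to[-\infty,\infty]$ $$\bigg(\int_{\mathbb{R}^n}\big(\mathcal{R}^n_\alpha f(x)\big)^{\frac{p(\delta-\kappa p)}{\delta-p\alpha}}\,d\mathcal{H}^{\delta-\kappa p}_\infty\bigg)^{\frac{\delta-p\alpha}{p(\delta-\kappa p)}}\le c\,\bigg(\int_{\mathbb{R}^n}|f(x)|^p\,d\mathcal{H}^\delta_\infty\bigg)^{\frac1p}.$$
   Context: For $\delta\in(0,n]$ and any set $E\subset\mathbb{R}^n$, the $\delta$-dimensional Hausdorff content is $\mathcal{H}^\delta_\infty(E):=\inf\{\sum_{i} r_i^\delta : E\subset\bigcup_{i} B(x_i,r_i)\}$, the infimum being over all countable (or finite) collections of open balls covering $E$. For an arbitrary set $\Omega\subset\mathbb{R}^n$ and an arbitrary function $g:\Omega\to[0,\infty]$ (no measurability required), the integral with respect to $\mathcal{H}^\delta_\infty$ is the Choquet integral $\int_\Omega g\,d\mathcal{H}^\delta_\infty:=\int_0^\infty \mathcal{H}^\delta_\infty(\{x\in\Omega: g(x)>t\})\,dt$. The Hausdorff content Riesz potential of $f:\mathbb{R}^n\to[-\infty,\infty]$ is, for $\delta\in(0,n]$ and $\alpha\in(0,\delta)$, $$\mathcal{R}^\delta_\alpha f(x):=\int_{\mathbb{R}^n}\frac{|f(y)|}{|x-y|^{\delta-\alpha}}\,d\mathcal{H}^\delta_\infty(y),\qquad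 x\in\mathbb{R}^n.$$ In particular $\mathcal{R}^n_\alpha f(x)=\int_{\mathbb{R}^n}|f(y)|\,|x-y|^{\alpha-n}\,d\mathcal{H}^n_\infty(y)$. *)

theory Defs
  imports "HOL-Analysis.Analysis"
begin

text \<open>The index set \<open>I\<close> of a cover is an arbitrary set of naturals, which covers both the
  finite and the countably infinite families of balls. Every infinite sum in \<^typ>\<open>ennreal\<close>
  exists, so \<^const>\<open>infsum\<close> carries no hidden summability condition.\<close>

definition hausdorff_content :: "real \<Rightarrow> (real ^ 'n) set \<Rightarrow> ennreal" where
  "hausdorff_content \<delta> E =
     Inf {(\<Sum>\<^sub>\<infinity>i\<in>I. ennreal (r i powr \<delta>)) | (I :: nat set) (x :: nat \<Rightarrow> real ^ 'n) (r :: nat \<Rightarrow> real).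
       (\<forall>i\<in>I. 0 < r i) \<and> E \<subseteq> (\<Union>i\<in>I. ball (x i) (r i))}"

text \<open>The outer integral is a Lebesgue integral of a nonincreasing, hence Borel measurable,
  function of \<open>t\<close>, whatever \<open>\<Omega>\<close> and \<open>g\<close> are.\<close>

definition choquet_integral ::
    "real \<Rightarrow> (real ^ 'n) set \<Rightarrow> (real ^ 'n \<Rightarrow> ennreal) \<Rightarrow> ennreal" where
  "choquet_integral \<delta> \<Omega> g =
     (\<integral>\<^sup>+t\<in>{0<..}. hausdorff_content \<delta> {x \<in> \<Omega>. ennreal t < g x} \<partial>lborel)"

text \<open>At \<open>y = x\<close> the integrand is \<open>\<infinity>\<close> if \<open>f x \<noteq> 0\<close> and \<open>0\<close> otherwise, by the conventions for
  division in \<^typ>\<open>ennreal\<close>. The value there does not affect the integral: for \<open>\<delta> > 0\<close> a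
  single point has content zero and the content is subadditive.\<close>

definition riesz_potential ::
    "real \<Rightarrow> real \<Rightarrow> (real ^ 'n \<Rightarrow> ereal) \<Rightarrow> real ^ 'n \<Rightarrow> ennreal" where
  "riesz_potential \<delta> \<alpha> f x =
     choquet_integral \<delta> UNIV (\<lambda>y. e2ennreal \<bar>f y\<bar> / ennreal (norm (x - y) powr (\<delta> - \<alpha>)))"

text \<open>Powers on \<open>[0,\<infinity>]\<close>, meant for exponents \<open>q > 0\<close> only; then \<open>0\<close> is sent to \<open>0\<close> and
  \<open>\<infinity>\<close> to \<open>\<infinity>\<close>.\<close>

definition ennreal_powr :: "ennreal \<Rightarrow> real \<Rightarrow> ennreal" where
  "ennreal_powr a q = (if a = \<infinity> then \<infinity> else ennreal (enn2real a powr q))"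

end

theory Submission
  imports Defs
begin

text \<open>The inequality is proved without maximal functions, by one covering argument for each level of the potential.
  Throughout \<open>H\<close> is \<open>\<delta>\<close>-dimensional content, \<open>d = \<delta> - \<kappa> p\<close>, \<open>\<beta> = \<delta> / p - \<alpha>\<close>, and \<open>q = d / \<beta>\<close> is the exponent on the left.

  Since \<open>n\<close>-dimensional content is bounded by a multiple of Lebesgue measure, the Riesz potential of a measurable
  \<open>f\<close> is at most a constant times the double dyadic sum
  \<open>\<Sum>m. \<Sum>k. 2 powr (m (\<alpha> - n)) * 2\<^sup>k * |E\<^sub>k \<inter> B(x, 2\<^sup>m)|\<close> with \<open>E\<^sub>k = {|f| > 2\<^sup>k}\<close>
  (\<open>riesz_potential_le\<close>). Each \<open>E\<^sub>k\<close> is covered by balls that are nearly optimal for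
  its \<open>\<delta>\<close>-dimensional content. Put \<open>w\<close> for (a multiple of) the right-hand norm.

  Fix a scale \<open>\<rho> = 2\<^sup>M\<close> and the threshold \<open>K w \<rho> powr (- \<beta>)\<close>. Because \<open>|E| \<le> C H(E) powr (n / \<delta>)\<close> and
  \<open>p > \<delta> / n\<close>, the average of \<open>|f|\<close> over a ball of radius \<open>r\<close> is at most \<open>C w r powr (- \<delta> / p)\<close>, so scales above \<open>\<rho>\<close>
  stay below the threshold. At scales \<open>r \<le> \<rho>\<close>, values of \<open>|f|\<close> below \<open>\<tau>\<^sub>r = s (\<rho> / r) powr lam\<close> with
  \<open>s = w \<rho> powr (- \<delta> / p)\<close> stay below the threshold as well, since \<open>lam < \<alpha>\<close> (\<open>potential_le\<close>). What remains
  is covered in two ways. Covering balls of high level and large radius are used directly, dilated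
  (\<open>content_big_balls\<close>). Points outside them at which the potential is large have a ball \<open>B(x, r)\<close> in which
  the average above \<open>\<tau>\<^sub>r\<close> exceeds \<open>\<tau>\<^sub>r\<close> and which meets only covering balls smaller than itself. After
  a Vitali selection, every covering ball meets boundedly many selected balls, and an auxiliary exponent
  \<open>p0 < p\<close> gives the bound for \<open>\<Sum> r powr d\<close> (\<open>content_crowded\<close>). Altogether the set where the potential exceeds the
  threshold has \<open>d\<close>-dimensional content at most
  \<open>C \<rho> powr (d - \<delta>) * s powr (- p0) * (\<Sum>k with 2\<^sup>k \<ge> s. 2 powr (k p0) * H(E\<^sub>k))\<close>, up to the near-optimality of
  the covers (\<open>content_superlevel_potential\<close>).

  The \<open>q\<close>-th powers of the thresholds are \<open>(K w) powr q * \<rho> powr (- d)\<close>. Summation of the last display against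
  them over the scales \<open>\<rho>\<close>, interchanged with the sum over \<open>k\<close>, is geometric because \<open>p0 < p\<close>, and yields
  \<open>C w powr (q - p) * (\<Sum>k. 2 powr (k p) * H(E\<^sub>k)) \<le> C w powr q\<close> (\<open>choquet_integral_le\<close>). This is the claim.\<close>

section \<open>Sums over dyadic scales\<close>

text \<open>The dyadic scale \<open>2\<^sup>k\<close>, for an integer \<open>k\<close>.\<close>

definition dy :: "int \<Rightarrow> real" where "dy k = 2 powr real_of_int k"

text \<open>Sum of a nonnegative extended-real family over its whole index type, as an integral against
  counting measure: monotonicity, linearity and Tonelli's theorem then come from integration.\<close>

abbreviation csum :: "('a \<Rightarrow> ennreal) \<Rightarrow> ennreal" where
  "csum f \<equiv> \<integral>\<^sup>+k. f k \<partial>count_space UNIV"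

text \<open>The sum of the geometric series \<open>\<Sum>j. 2 powr (- b * j)\<close>, for \<open>b > 0\<close>.\<close>

definition geo :: "real \<Rightarrow> real" where "geo b = 1 / (1 - 2 powr (- b))"

lemma dy_pos [simp]: "0 < dy k" and dy_nonneg [simp]: "0 \<le> dy k" and dy_nonzero [simp]: "dy k \<noteq> 0"
  by (auto simp: dy_def)

lemma dy_le_iff [simp]: "dy k \<le> dy l \<longleftrightarrow> k \<le> l" by (simp add: dy_def)
lemma dy_less_iff [simp]: "dy k < dy l \<longleftrightarrow> k < l" by (simp add: dy_def)
lemma dy_add: "dy (k + l) = dy k * dy l" by (simp add: dy_def powr_add)
lemma dy_minus: "dy (- k) = 1 / dy k" by (simp add: dy_def powr_minus_divide)
lemma dy_1 [simp]: "dy 1 = 2" by (simp add: dy_def)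

lemma dy_floor: assumes "0 < v" obtains k where "dy k \<le> v" "v < 2 * dy k"
proof -
  let ?k = "\<lfloor>log 2 v\<rfloor>"
  have v: "v = 2 powr (log 2 v)" using assms by simp
  have "dy ?k \<le> v" unfolding dy_def by (subst (2) v) (intro powr_mono, auto)
  moreover have "v < 2 powr (real_of_int ?k + 1)" by (subst v) (intro powr_less_mono, auto)
  ultimately show ?thesis using that by (auto simp: dy_def powr_add)
qed

lemma dy_ceiling: assumes "0 < v" obtains k where "dy k < v" "v \<le> 2 * dy k"
proof -
  let ?k = "\<lceil>log 2 v\<rceil> - 1"
  have v: "v = 2 powr (log 2 v)" using assms by simp
  have "dy ?k < 2 powr (log 2 v)" unfolding dy_def by (intro powr_less_mono) linarith+
  then have "dy ?k < v" using v by simp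
  have "v \<le> 2 powr (real_of_int ?k + 1)" by (subst v) (intro powr_mono, auto)
  then have "v \<le> 2 * dy ?k" by (simp add: dy_def powr_diff)
  with \<open>dy ?k < v\<close> show ?thesis using that by blast
qed

lemma geo_pos: "0 < b \<Longrightarrow> 0 < geo b" by (simp add: geo_def powr_less_one)

lemma csum_swap: fixes f :: "'a::countable \<Rightarrow> 'b::countable \<Rightarrow> ennreal"
  shows "csum (\<lambda>i. csum (f i)) = csum (\<lambda>j. csum (\<lambda>i. f i j))"
  by (rule nn_integral_count_space_nn_integral) auto

lemma csum_dy_ge:
  assumes b: "0 < b" and v: "0 < v"
  shows "csum (\<lambda>k. if v \<le> dy k then ennreal (dy k powr (- b)) else 0) \<le> ennreal (geo b * v powr (- b))"
proof -
  define K where "K = \<lceil>log 2 v\<rceil>"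
  have iff: "v \<le> dy k \<longleftrightarrow> k \<in> {K..}" for k
  proof -
    have "v \<le> dy k \<longleftrightarrow> log 2 v \<le> real_of_int k" unfolding dy_def using v by (subst le_powr_iff) auto
    then show ?thesis by (simp add: K_def ceiling_le_iff)
  qed
  have bij: "bij_betw (\<lambda>j::nat. K + int j) UNIV {K..}"
    by (rule bij_betwI[where g="\<lambda>k. nat (k - K)"]) auto
  have q: "norm (2 powr (- b)) < 1" using b by (simp add: powr_less_one)
  have "csum (\<lambda>k. if v \<le> dy k then ennreal (dy k powr (- b)) else 0)
      = csum (\<lambda>k. ennreal (dy k powr (- b)) * indicator {K..} k)"
    by (intro nn_integral_cong) (auto simp: iff)
  also have "\<dots> = (\<integral>\<^sup>+k. ennreal (dy k powr (- b)) \<partial>count_space {K..})"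
    by (simp add: nn_integral_count_space_indicator)
  also have "\<dots> = csum (\<lambda>j::nat. ennreal (dy (K + int j) powr (- b)))"
    by (rule nn_integral_bij_count_space[OF bij, symmetric])
  also have "\<dots> = (\<Sum>j. ennreal (dy K powr (- b) * (2 powr (- b)) ^ j))"
    unfolding nn_integral_count_space_nat
    by (intro suminf_cong arg_cong[where f=ennreal])
       (simp add: dy_def powr_powr powr_add[symmetric] powr_realpow[symmetric] algebra_simps)
  also have "\<dots> = ennreal (dy K powr (- b) * geo b)"
    unfolding geo_def using geometric_sums[OF q]
    by (intro suminf_ennreal_eq sums_mult) auto
  also have "\<dots> \<le> ennreal (geo b * v powr (- b))"
  proof (rule ennreal_leI)
    have "v \<le> dy K" by (simp add: iff)
    then have "dy K powr (- b) \<le> v powr (- b)" using b v by (intro powr_mono2') auto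
    then show "dy K powr (- b) * geo b \<le> geo b * v powr (- b)"
      using geo_pos[OF b] by (simp add: mult.commute)
  qed
  finally show ?thesis .
qed

lemma csum_dy_le:
  assumes b: "0 < b" and v: "0 < v"
  shows "csum (\<lambda>k. if dy k \<le> v then ennreal (dy k powr b) else 0) \<le> ennreal (geo b * v powr b)"
proof -
  have bij: "bij_betw (uminus :: int \<Rightarrow> int) UNIV UNIV" by (simp add: bij_uminus)
  have *: "dy k \<le> v \<longleftrightarrow> 1 / v \<le> dy (- k)" "dy k powr b = dy (- k) powr (- b)" for k
    using v by (simp_all add: dy_minus frac_le_eq field_simps) (simp add: dy_def powr_powr powr_minus powr_divide)
  have "csum (\<lambda>k. if dy k \<le> v then ennreal (dy k powr b) else 0)
     = csum (\<lambda>k. (\<lambda>k. if 1/v \<le> dy k then ennreal (dy k powr (- b)) else 0) (- k))"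
    unfolding * by simp
  also have "\<dots> = csum (\<lambda>k. if 1/v \<le> dy k then ennreal (dy k powr (- b)) else 0)"
    by (rule nn_integral_bij_count_space[OF bij])
  also have "\<dots> \<le> ennreal (geo b * (1/v) powr (- b))"
    using b v by (intro csum_dy_ge) auto
  also have "(1/v) powr (- b) = v powr b" using v by (simp add: powr_minus powr_divide)
  finally show ?thesis .
qed


lemma csum_mono: "(\<And>k. f k \<le> g k) \<Longrightarrow> csum f \<le> csum g" by (intro nn_integral_mono) auto
lemma csum_cmult: "csum (\<lambda>k. c * f k) = c * csum f" by (intro nn_integral_cmult) auto
lemma csum_add: "csum (\<lambda>k. f k + g k) = csum f + csum g" by (intro nn_integral_add) auto
lemma csum_ge: "f k \<le> csum f"
proof -
  have "f k = (\<integral>\<^sup>+i. f i * indicator {k} i \<partial>count_space UNIV)"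
    by (subst nn_integral_indicator_finite) auto
  also have "\<dots> \<le> csum f" by (intro nn_integral_mono) (auto simp: indicator_def)
  finally show ?thesis .
qed

lemma csum_single: assumes "\<And>k. k \<noteq> k0 \<Longrightarrow> f k = 0" shows "csum f = f k0"
proof -
  have "csum f = (\<integral>\<^sup>+k. f k * indicator {k0} k \<partial>count_space UNIV)"
    using assms by (intro nn_integral_cong) (auto simp: indicator_def)
  then show ?thesis by (subst (asm) nn_integral_indicator_finite) auto
qed

lemma nn_integral_csum:
  fixes f :: "'i::countable \<Rightarrow> 'a \<Rightarrow> ennreal"
  assumes "\<And>i. f i \<in> borel_measurable M"
  shows "(\<integral>\<^sup>+x. csum (\<lambda>i. f i x) \<partial>M) = csum (\<lambda>i. \<integral>\<^sup>+x. f i x \<partial>M)"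
  using assms by (intro nn_integral_count_space_nn_integral) auto

lemma borel_measurable_csum:
  fixes f :: "'i::countable \<Rightarrow> 'a \<Rightarrow> ennreal"
  assumes f: "\<And>i. f i \<in> borel_measurable M"
  shows "(\<lambda>x. csum (\<lambda>i. f i x)) \<in> borel_measurable M"
proof -
  have "csum (\<lambda>i. f i x) = (\<Sum>n. if n \<in> range (to_nat :: 'i \<Rightarrow> nat) then f (from_nat n) x else 0)" for x
  proof -
    have "csum (\<lambda>i. f i x) = csum (\<lambda>i::'i. f (from_nat (to_nat i)) x)" by simp
    also have "\<dots> = (\<integral>\<^sup>+n. f (from_nat n) x \<partial>count_space (range (to_nat :: 'i \<Rightarrow> nat)))"
      by (rule nn_integral_bij_count_space) (simp add: bij_betw_def)
    also have "\<dots> = csum (\<lambda>n. if n \<in> range (to_nat :: 'i \<Rightarrow> nat) then f (from_nat n) x else 0)"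
      by (subst nn_integral_count_space_indicator) (auto intro!: nn_integral_cong simp: indicator_def)
    finally show ?thesis by (simp only: nn_integral_count_space_nat)
  qed
  then show ?thesis using f by simp
qed

text \<open>Think of \<open>a k\<close> as the measure of \<open>{|f| > 2\<^sup>k} \<inter> B(y, \<rho>)\<close>, and of \<open>B\<close> as the \<open>p\<close>-th power of a
  weak \<open>L\<^sup>p\<close> norm of \<open>f\<close> with respect to \<open>\<delta>\<close>-dimensional content. The lemma is then the bound
  \<open>\<integral>\<^bsub>B(y,\<rho>)\<^esub> |f| \<le> C \<rho> powr N * (B / \<rho> powr \<delta>) powr (1 / p)\<close>. The trivial bound \<open>a1\<close> is used for the levels
  \<open>2\<^sup>k \<le> v\<close> and the content bound \<open>a2\<close> for \<open>2\<^sup>k \<ge> v\<close>, where the two bounds agree at \<open>v\<close>. The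
  high levels are summable because \<open>p N / \<delta> > 1\<close>; that is the role of the hypothesis \<open>p > \<delta> / N\<close>,
  which admits \<open>p \<le> 1\<close>.\<close>

lemma csum_dyadic_min_le:
  fixes a :: "int \<Rightarrow> ennreal"
  assumes \<delta>: "0 < \<delta>" and p: "\<delta> / N < p" "0 < N" and \<rho>: "0 < \<rho>" and B: "0 \<le> B" and \<omega>: "0 < \<omega>"
    and a1: "\<And>k. a k \<le> ennreal (\<omega> * \<rho> powr N)"
    and a2: "\<And>k. a k \<le> ennreal (\<omega> * (B * dy k powr (- p)) powr (N / \<delta>))"
  shows "csum (\<lambda>k. ennreal (dy k) * a k)
    \<le> ennreal ((geo 1 + geo (p * N / \<delta> - 1)) * \<omega> * \<rho> powr N * (B * \<rho> powr (- \<delta>)) powr (1 / p))"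
proof (cases "B = 0")
  case True
  then have "a k = 0" for k using a2[of k] by (simp add: True)
  then show ?thesis by simp
next
  case False
  then have B: "0 < B" using B by simp
  have p0: "0 < p" using p \<delta> by (meson divide_pos_pos less_trans)
  \<comment> \<open>the level at which the bounds \<open>a1\<close> and \<open>a2\<close> coincide\<close>
  define v where "v = (B * \<rho> powr (- \<delta>)) powr (1 / p)"
  have v: "0 < v" using B \<rho> by (simp add: v_def)
  define \<gamma> where "\<gamma> = p * N / \<delta>"
  have \<gamma>: "1 < \<gamma>" using p \<delta> by (simp add: \<gamma>_def field_simps)
  have vp: "v powr p = B * \<rho> powr (- \<delta>)" using B \<rho> p0 by (simp add: v_def powr_powr)
  have a2': "ennreal (dy k) * a k \<le> ennreal (\<omega> * \<rho> powr N * v powr \<gamma>) * ennreal (dy k powr (- (\<gamma> - 1)))" for k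
  proof -
    have Beq: "B = v powr p * \<rho> powr \<delta>" using vp \<rho> by (simp add: powr_minus field_simps)
    have "(B * dy k powr (- p)) powr (N / \<delta>) = v powr \<gamma> * \<rho> powr N * dy k powr (- \<gamma>)"
      using \<delta> v \<rho> unfolding Beq by (simp add: powr_mult powr_powr \<gamma>_def)
    then have "dy k * (\<omega> * (B * dy k powr (- p)) powr (N / \<delta>)) = (\<omega> * \<rho> powr N * v powr \<gamma>) * (dy k powr 1 * dy k powr (- \<gamma>))"
      by (simp add: powr_one)
    also have "dy k powr 1 * dy k powr (- \<gamma>) = dy k powr (- (\<gamma> - 1))"
      by (subst powr_add[symmetric]) simp
    finally have eq: "dy k * (\<omega> * (B * dy k powr (- p)) powr (N / \<delta>)) = (\<omega> * \<rho> powr N * v powr \<gamma>) * dy k powr (- (\<gamma> - 1))" .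
    have "ennreal (dy k) * a k \<le> ennreal (dy k) * ennreal (\<omega> * (B * dy k powr (- p)) powr (N / \<delta>))"
      by (intro mult_left_mono a2) simp
    also have "\<dots> = ennreal (\<omega> * \<rho> powr N * v powr \<gamma>) * ennreal (dy k powr (- (\<gamma> - 1)))"
      using \<omega> by (subst (1 2) ennreal_mult[symmetric]) (auto simp: eq)
    finally show ?thesis .
  qed
  have a1': "ennreal (dy k) * a k \<le> ennreal (\<omega> * \<rho> powr N) * ennreal (dy k powr 1)" for k
    using mult_left_mono[OF a1, of "ennreal (dy k)" k] by (simp add: mult.commute)
  have "csum (\<lambda>k. ennreal (dy k) * a k) \<le>
      csum (\<lambda>k. ennreal (\<omega> * \<rho> powr N) * (if dy k \<le> v then ennreal (dy k powr 1) else 0)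
       + ennreal (\<omega> * \<rho> powr N * v powr \<gamma>) * (if v \<le> dy k then ennreal (dy k powr (- (\<gamma> - 1))) else 0))"
  proof (rule csum_mono)
    fix k
    show "ennreal (dy k) * a k \<le> ennreal (\<omega> * \<rho> powr N) * (if dy k \<le> v then ennreal (dy k powr 1) else 0)
       + ennreal (\<omega> * \<rho> powr N * v powr \<gamma>) * (if v \<le> dy k then ennreal (dy k powr (- (\<gamma> - 1))) else 0)"
    proof (cases "dy k \<le> v")
      case True then show ?thesis using add_mono[OF a1'[of k] zero_le] by simp
    next
      case False then show ?thesis using a2'[of k] by simp
    qed
  qed
  also have "\<dots> \<le> ennreal (\<omega> * \<rho> powr N) * ennreal (geo 1 * v powr 1)
       + ennreal (\<omega> * \<rho> powr N * v powr \<gamma>) * ennreal (geo (\<gamma> - 1) * v powr (- (\<gamma> - 1)))"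
    unfolding csum_add csum_cmult using v \<gamma>
    by (intro add_mono mult_left_mono csum_dy_le csum_dy_ge) auto
  also have "\<dots> = ennreal (\<omega> * \<rho> powr N * (geo 1 * v powr 1) + \<omega> * \<rho> powr N * v powr \<gamma> * (geo (\<gamma> - 1) * v powr (- (\<gamma> - 1))))"
    using \<omega> geo_pos[of 1] geo_pos[of "\<gamma> - 1"] \<gamma>
    by (simp add: ennreal_mult'[symmetric] flip: ennreal_plus)
  also have "\<omega> * \<rho> powr N * (geo 1 * v powr 1) + \<omega> * \<rho> powr N * v powr \<gamma> * (geo (\<gamma> - 1) * v powr (- (\<gamma> - 1)))
     = \<omega> * \<rho> powr N * (geo 1 * v powr 1 + geo (\<gamma> - 1) * (v powr \<gamma> * v powr (- (\<gamma> - 1))))"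
    by (simp add: algebra_simps)
  also have "v powr \<gamma> * v powr (- (\<gamma> - 1)) = v powr 1" by (subst powr_add[symmetric]) simp
  finally show ?thesis using v by (simp add: v_def \<gamma>_def algebra_simps)
qed

text \<open>A layer-cake integral of a nonincreasing function is comparable to its dyadic sum.\<close>

lemma nn_integral_antimono_le_csum:
  fixes h :: "real \<Rightarrow> ennreal"
  assumes anti: "\<And>s t. 0 < s \<Longrightarrow> s \<le> t \<Longrightarrow> h t \<le> h s" and c: "0 < c" and b: "0 < b"
  shows "(\<integral>\<^sup>+t\<in>{0<..}. h t \<partial>lborel) \<le> csum (\<lambda>k. ennreal (c * dy (k + 1) powr b) * h (c * dy k powr b))"
proof -
  define I where "I k = {c * dy k powr b ..< c * dy (k + 1) powr b}" for k
  have "(\<integral>\<^sup>+t\<in>{0<..}. h t \<partial>lborel) \<le> (\<integral>\<^sup>+t. csum (\<lambda>k. h (c * dy k powr b) * indicator (I k) t) \<partial>lborel)"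
  proof (intro nn_integral_mono)
    fix t :: real
    show "h t * indicator {0<..} t \<le> csum (\<lambda>k. h (c * dy k powr b) * indicator (I k) t)"
    proof (cases "0 < t")
      case True
      obtain k where k: "dy k \<le> (t / c) powr (1 / b)" "(t / c) powr (1 / b) < 2 * dy k"
        using dy_floor[of "(t / c) powr (1 / b)"] True c by auto
      have e: "((t / c) powr (1 / b)) powr b = t / c" using True c b by (simp add: powr_powr)
      have "dy k powr b \<le> ((t / c) powr (1 / b)) powr b"
        using k b by (intro powr_mono2) auto
      then have 1: "c * dy k powr b \<le> t" using c by (simp add: e field_simps)
      have "((t / c) powr (1 / b)) powr b < dy (k + 1) powr b"
        using k b by (intro powr_less_mono2) (auto simp: dy_add)
      then have 2: "t < c * dy (k + 1) powr b" using c by (simp add: e field_simps)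
      have "h t \<le> h (c * dy k powr b) * indicator (I k) t"
        using 1 2 c anti[of "c * dy k powr b" t] by (simp add: I_def)
      also have "\<dots> \<le> csum (\<lambda>k. h (c * dy k powr b) * indicator (I k) t)" by (rule csum_ge)
      finally show ?thesis using True by simp
    qed simp
  qed
  also have "\<dots> = csum (\<lambda>k. \<integral>\<^sup>+t. h (c * dy k powr b) * indicator (I k) t \<partial>lborel)"
    by (intro nn_integral_csum) (simp add: I_def)
  also have "\<dots> \<le> csum (\<lambda>k. ennreal (c * dy (k + 1) powr b) * h (c * dy k powr b))"
  proof (intro csum_mono)
    fix k
    have le: "c * dy k powr b \<le> c * dy (k + 1) powr b" using b c by (intro mult_left_mono powr_mono2) auto
    have "(\<integral>\<^sup>+t. h (c * dy k powr b) * indicator (I k) t \<partial>lborel)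
        = h (c * dy k powr b) * ennreal (c * dy (k + 1) powr b - c * dy k powr b)"
      using le by (subst nn_integral_cmult_indicator) (auto simp: I_def)
    also have "\<dots> \<le> h (c * dy k powr b) * ennreal (c * dy (k + 1) powr b)"
      using c by (intro mult_left_mono ennreal_leI) auto
    finally show "(\<integral>\<^sup>+t. h (c * dy k powr b) * indicator (I k) t \<partial>lborel)
       \<le> ennreal (c * dy (k + 1) powr b) * h (c * dy k powr b)" by (simp add: mult.commute)
  qed
  finally show ?thesis .
qed

lemma csum_le_nn_integral_antimono:
  fixes h :: "real \<Rightarrow> ennreal"
  assumes anti: "\<And>s t. 0 < s \<Longrightarrow> s \<le> t \<Longrightarrow> h t \<le> h s" and b: "0 < b"
  shows "csum (\<lambda>k. ennreal (dy k powr b) * h (dy k powr b)) \<le> ennreal (geo b) * (\<integral>\<^sup>+t\<in>{0<..}. h t \<partial>lborel)"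
proof -
  \<comment> \<open>disjoint intervals of length \<open>dy k powr b / geo b\<close>\<close>
  define I where "I k = {dy (k - 1) powr b ..< dy k powr b}" for k
  have disj: "k = l" if "t \<in> I k" "t \<in> I l" for k l t
  proof -
    have "dy (k - 1) powr b < dy l powr b" "dy (l - 1) powr b < dy k powr b"
      using that by (auto simp: I_def)
    then have "dy (k - 1) < dy l" "dy (l - 1) < dy k"
      using b by (metis dy_nonneg not_less powr_mono2 less_imp_le)+
    then show "k = l" by simp
  qed
  have len: "dy k powr b = geo b * (dy k powr b - dy (k - 1) powr b)" for k
  proof -
    have "dy (k - 1) powr b = dy k powr b * 2 powr (- b)"
      by (simp add: dy_def powr_powr powr_add[symmetric] algebra_simps)
    then have "dy k powr b - dy (k - 1) powr b = dy k powr b * (1 - 2 powr (- b))" by (simp add: algebra_simps)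
    then show ?thesis using b powr_less_one[of 2 "- b"] by (simp add: geo_def)
  qed
  have le: "dy (k - 1) powr b \<le> dy k powr b" for k using b by (intro powr_mono2) auto
  have "csum (\<lambda>k. ennreal (dy k powr b) * h (dy k powr b))
      = csum (\<lambda>k. ennreal (geo b) * (\<integral>\<^sup>+t. h (dy k powr b) * indicator (I k) t \<partial>lborel))"
  proof (intro nn_integral_cong)
    fix k
    have "(\<integral>\<^sup>+t. h (dy k powr b) * indicator (I k) t \<partial>lborel) = h (dy k powr b) * ennreal (dy k powr b - dy (k - 1) powr b)"
      using le[of k] by (subst nn_integral_cmult_indicator) (auto simp: I_def)
    then show "ennreal (dy k powr b) * h (dy k powr b) = ennreal (geo b) * (\<integral>\<^sup>+t. h (dy k powr b) * indicator (I k) t \<partial>lborel)"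
      using geo_pos[OF b] by (subst (1) len) (simp add: ennreal_mult' mult_ac)
  qed
  also have "\<dots> = ennreal (geo b) * (\<integral>\<^sup>+t. csum (\<lambda>k. h (dy k powr b) * indicator (I k) t) \<partial>lborel)"
    unfolding csum_cmult by (subst nn_integral_csum) (simp_all add: I_def)
  also have "\<dots> \<le> ennreal (geo b) * (\<integral>\<^sup>+t\<in>{0<..}. h t \<partial>lborel)"
  proof (intro mult_left_mono nn_integral_mono)
    fix t :: real
    show "csum (\<lambda>k. h (dy k powr b) * indicator (I k) t) \<le> h t * indicator {0<..} t"
    proof (cases "\<exists>k. t \<in> I k")
      case False then show ?thesis by simp
    next
      case True
      then obtain k where k: "t \<in> I k" by blast
      have "csum (\<lambda>k. h (dy k powr b) * indicator (I k) t) = h (dy k powr b) * indicator (I k) t"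
        using disj[OF k] by (intro csum_single) (auto simp: indicator_def)
      also have "\<dots> \<le> h t * indicator {0<..} t"
      proof -
        have "0 < t" "t \<le> dy k powr b" using k by (auto simp: I_def intro: less_le_trans[of 0 "dy (k - 1) powr b"])
        then show ?thesis using k anti[of t "dy k powr b"] by simp
      qed
      finally show ?thesis .
    qed
  qed simp
  finally show ?thesis .
qed

section \<open>Hausdorff content and Lebesgue measure\<close>

lemma infsum_eq_csum: fixes f :: "nat \<Rightarrow> ennreal"
  shows "infsum f I = csum (\<lambda>i. if i \<in> I then f i else 0)"
proof -
  have "infsum f I = infsum (\<lambda>i. if i \<in> I then f i else 0) UNIV"
    by (intro infsum_cong_neutral) auto
  also have "\<dots> = (\<Sum>i. if i \<in> I then f i else 0)"
    by (intro sums_unique has_sum_imp_sums has_sum_infsum nonneg_summable_on_complete) simp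
  finally show ?thesis by (simp add: nn_integral_count_space_nat)
qed

text \<open>Covers may be indexed by any countable set, and balls of radius \<open>\<le> 0\<close>, which are empty, may
  occur.\<close>

lemma hausdorff_content_le_cover:
  fixes x :: "'i \<Rightarrow> real ^ 'n"
  assumes S: "countable S" and E: "E \<subseteq> (\<Union>i\<in>S. ball (x i) (r i))"
  shows "hausdorff_content \<delta> E \<le> (\<integral>\<^sup>+i. ennreal (r i powr \<delta>) \<partial>count_space S)"
proof -
  define S' where "S' = {i \<in> S. 0 < r i}"
  define I where "I = to_nat_on S' ` S'"
  define g where "g = inv_into S' (to_nat_on S')"
  have cS': "countable S'" using S by (auto simp: S'_def)
  have bij: "bij_betw g I S'"
    unfolding g_def I_def using cS'
    by (intro bij_betw_inv_into inj_on_imp_bij_betw inj_on_to_nat_on)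
  have img: "g ` I = S'" using bij by (simp add: bij_betw_def)
  have cover: "E \<subseteq> (\<Union>i\<in>I. ball (x (g i)) (r (g i)))"
  proof
    fix y assume "y \<in> E"
    then obtain i where i: "i \<in> S" "y \<in> ball (x i) (r i)" using E by auto
    then have "0 < r i" using zero_le_dist[of "x i" y] by (auto simp del: zero_le_dist)
    then have "i \<in> g ` I" using i img by (auto simp: S'_def)
    then show "y \<in> (\<Union>i\<in>I. ball (x (g i)) (r (g i)))" using i by auto
  qed
  have r_pos: "\<forall>i\<in>I. 0 < r (g i)" using img by (auto simp: S'_def)
  have "hausdorff_content \<delta> E \<le> (\<Sum>\<^sub>\<infinity>i\<in>I. ennreal (r (g i) powr \<delta>))"
    unfolding hausdorff_content_def
    by (intro Inf_lower CollectI exI[of _ I] exI[of _ "\<lambda>i. x (g i)"] exI[of _ "\<lambda>i. r (g i)"]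
          conjI refl r_pos cover)
  also have "\<dots> = (\<integral>\<^sup>+i. ennreal (r (g i) powr \<delta>) \<partial>count_space I)"
    unfolding infsum_eq_csum
    by (subst nn_integral_count_space_indicator) (auto intro!: nn_integral_cong simp: indicator_def)
  also have "\<dots> = (\<integral>\<^sup>+i. ennreal (r i powr \<delta>) \<partial>count_space S')"
    by (rule nn_integral_bij_count_space[OF bij])
  also have "\<dots> \<le> (\<integral>\<^sup>+i. ennreal (r i powr \<delta>) \<partial>count_space S)"
    by (subst (1 2) nn_integral_count_space_indicator)
       (auto intro!: nn_integral_mono simp: S'_def indicator_def)
  finally show ?thesis .
qed

lemma hausdorff_content_cover:
  fixes E :: "(real ^ 'n) set"
  assumes "hausdorff_content \<delta> E < \<eta>"
  obtains x :: "nat \<Rightarrow> real ^ 'n" and r :: "nat \<Rightarrow> real" where "E \<subseteq> (\<Union>j. ball (x j) (r j))" "\<forall>j. 0 \<le> r j"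
    "csum (\<lambda>j. ennreal (r j powr \<delta>)) < \<eta>"
proof -
  from assms obtain I :: "nat set" and x :: "nat \<Rightarrow> real ^ 'n" and r
    where *: "\<forall>i\<in>I. 0 < r i" "E \<subseteq> (\<Union>i\<in>I. ball (x i) (r i))"
      "(\<Sum>\<^sub>\<infinity>i\<in>I. ennreal (r i powr \<delta>)) < \<eta>"
    unfolding hausdorff_content_def Inf_less_iff by blast
  show ?thesis
  proof (rule that[of x "\<lambda>i. if i \<in> I then r i else 0"])
    show "\<forall>i. 0 \<le> (if i \<in> I then r i else 0)" using * by (auto intro: less_imp_le)
    show "E \<subseteq> (\<Union>i. ball (x i) (if i \<in> I then r i else 0))" using *(2) by fastforce
    have "csum (\<lambda>i. ennreal ((if i \<in> I then r i else 0) powr \<delta>)) =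
        csum (\<lambda>i. if i \<in> I then ennreal (r i powr \<delta>) else 0)"
      by (intro nn_integral_cong) auto
    then show "csum (\<lambda>i. ennreal ((if i \<in> I then r i else 0) powr \<delta>)) < \<eta>"
      using *(3) by (simp add: infsum_eq_csum)
  qed
qed

lemma hausdorff_content_mono: "A \<subseteq> B \<Longrightarrow> hausdorff_content \<delta> A \<le> hausdorff_content \<delta> B"
  unfolding hausdorff_content_def by (rule Inf_superset_mono) blast

lemma hausdorff_content_Un:
  fixes A B :: "(real ^ 'n) set"
  shows "hausdorff_content \<delta> (A \<union> B) \<le> hausdorff_content \<delta> A + hausdorff_content \<delta> B"
proof (rule ennreal_le_epsilon)
  fix e :: real assume e: "0 < e" and fin: "hausdorff_content \<delta> A + hausdorff_content \<delta> B < top"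
  have less: "hausdorff_content \<delta> C < hausdorff_content \<delta> C + ennreal (e / 2)"
    if "hausdorff_content \<delta> C < top" for C :: "(real ^ 'n) set"
  proof -
    have "0 < ennreal (e / 2)" using e by simp
    then have "hausdorff_content \<delta> C + 0 < hausdorff_content \<delta> C + ennreal (e / 2)"
      using that by (subst ennreal_add_left_cancel_less) auto
    then show ?thesis by (simp only: add_0_right)
  qed
  have finA: "hausdorff_content \<delta> A < top" and finB: "hausdorff_content \<delta> B < top"
    using fin by auto
  obtain x :: "nat \<Rightarrow> real ^ 'n" and r :: "nat \<Rightarrow> real" where 1: "A \<subseteq> (\<Union>j::nat. ball (x j) (r j))" "\<forall>j. 0 \<le> r j"
    "csum (\<lambda>j. ennreal (r j powr \<delta>)) < hausdorff_content \<delta> A + ennreal (e / 2)"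
    by (rule hausdorff_content_cover[OF less[OF finA]])
  obtain x' :: "nat \<Rightarrow> real ^ 'n" and r' :: "nat \<Rightarrow> real" where 2: "B \<subseteq> (\<Union>j::nat. ball (x' j) (r' j))" "\<forall>j. 0 \<le> r' j"
    "csum (\<lambda>j. ennreal (r' j powr \<delta>)) < hausdorff_content \<delta> B + ennreal (e / 2)"
    by (rule hausdorff_content_cover[OF less[OF finB]])
  define X where "X = (\<lambda>(b, j). if b then x j else x' j)"
  define R where "R = (\<lambda>(b, j). if b then r j else r' j)"
  have "A \<union> B \<subseteq> (\<Union>i. ball (X i) (R i))"
  proof
    fix y assume "y \<in> A \<union> B"
    then consider j where "y \<in> ball (X (True, j)) (R (True, j))" | j where "y \<in> ball (X (False, j)) (R (False, j))"
      using 1(1) 2(1) by (auto simp: X_def R_def)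
    then show "y \<in> (\<Union>i. ball (X i) (R i))" by cases blast+
  qed
  then have "hausdorff_content \<delta> (A \<union> B) \<le> csum (\<lambda>i. ennreal (R i powr \<delta>))"
    by (intro hausdorff_content_le_cover) auto
  also have "\<dots> = csum (\<lambda>b. csum (\<lambda>j. ennreal (R (b, j) powr \<delta>)))"
    by (rule nn_integral_fst_count_space[symmetric])
  also have "\<dots> = csum (\<lambda>j. ennreal (r j powr \<delta>)) + csum (\<lambda>j. ennreal (r' j powr \<delta>))"
    by (subst nn_integral_count_space_finite) (auto simp: UNIV_bool R_def add.commute)
  also have "\<dots> \<le> (hausdorff_content \<delta> A + ennreal (e / 2)) + (hausdorff_content \<delta> B + ennreal (e / 2))"
    using 1(3) 2(3) by (intro add_mono) auto
  also have "\<dots> = hausdorff_content \<delta> A + hausdorff_content \<delta> B + (ennreal (e / 2) + ennreal (e / 2))"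
    by (simp add: ac_simps)
  also have "ennreal (e / 2) + ennreal (e / 2) = ennreal e"
    using e by (subst ennreal_plus[symmetric]) auto
  finally show "hausdorff_content \<delta> (A \<union> B) \<le> hausdorff_content \<delta> A + hausdorff_content \<delta> B + ennreal e" .
qed

text \<open>The volume of the unit ball of \<open>\<real>\<^sup>n\<close>.\<close>

abbreviation uball :: "'n::finite itself \<Rightarrow> real" where
  "uball T \<equiv> unit_ball_vol (real CARD('n))"

lemma uball_pos: "0 < uball TYPE('n::finite)" by simp

lemma uball_nonzero [simp]: "uball TYPE('n::finite) \<noteq> 0"
  using uball_pos[where 'n='n] by (rule less_imp_neq[symmetric])

lemma emeasure_lebesgue_cball: "0 < r \<Longrightarrow> emeasure lebesgue (cball (c::real^'n) r) = ennreal (uball TYPE('n) * r powr CARD('n))"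
  by (simp add: emeasure_cball powr_realpow)

lemma emeasure_lebesgue_ball: "0 < r \<Longrightarrow> emeasure lebesgue (ball (c::real^'n) r) = ennreal (uball TYPE('n) * r powr CARD('n))"
  by (simp add: emeasure_ball powr_realpow)

text \<open>Vitali's covering lemma, applied to an open superset of nearly the same measure.\<close>

lemma hausdorff_content_le_lebesgue:
  fixes E :: "(real ^ 'n) set"
  assumes E: "E \<in> sets lebesgue"
  shows "hausdorff_content CARD('n) E \<le> ennreal (6 ^ CARD('n) / uball TYPE('n)) * emeasure lebesgue E"
proof -
  define c where "c = 6 ^ CARD('n) / uball TYPE('n)"
  have c: "0 < c" by (simp add: c_def)
  have "hausdorff_content CARD('n) E \<le> ennreal c * emeasure lebesgue E"
  proof (rule ennreal_le_epsilon)
    fix e :: real assume e: "0 < e" and "ennreal c * emeasure lebesgue E < top"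
    obtain T where T: "open T" "E \<subseteq> T" "emeasure lebesgue (T - E) < ennreal (e / c)"
      using sets_lebesgue_outer_open[OF E divide_pos_pos[OF e c]] by blast
    have Tm: "T \<in> sets lebesgue" using T(1) by auto
    have "\<exists>d. 0 < d \<and> d \<le> 1 \<and> cball x d \<subseteq> T" if x: "x \<in> T" for x
    proof -
      obtain d where "0 < d" "cball x d \<subseteq> T" using T(1) x unfolding open_contains_cball by blast
      then show ?thesis by (intro exI[of _ "min d 1"]) auto
    qed
    then obtain d where d: "\<And>x. x \<in> T \<Longrightarrow> 0 < d x \<and> d x \<le> 1 \<and> cball x (d x) \<subseteq> T" by metis
    have sub: "T \<subseteq> (\<Union>i\<in>T. cball i (d i))"
    proof
      fix x assume "x \<in> T"
      then have "x \<in> cball x (d x)" using d[of x] by simp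
      then show "x \<in> (\<Union>i\<in>T. cball i (d i))" using \<open>x \<in> T\<close> by blast
    qed
    have dd: "0 < d i \<and> d i \<le> 1" if "i \<in> T" for i using d[OF that] by simp
    obtain C where C: "countable C" "C \<subseteq> T"
      "pairwise (\<lambda>i j. disjnt (cball i (d i)) (cball j (d j))) C" "T \<subseteq> (\<Union>i\<in>C. cball i (5 * d i))"
      by (rule Vitali_covering_lemma_cballs[OF sub dd])
    have "E \<subseteq> (\<Union>i\<in>C. ball i (6 * d i))"
    proof
      fix y assume "y \<in> E"
      then obtain i where "i \<in> C" "dist i y \<le> 5 * d i" using T(2) C(4) by auto
      moreover have "0 < d i" using d C(2) \<open>i \<in> C\<close> by auto
      ultimately show "y \<in> (\<Union>i\<in>C. ball i (6 * d i))" by (auto intro!: bexI[of _ i])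
    qed
    then have "hausdorff_content CARD('n) E \<le> (\<integral>\<^sup>+i. ennreal ((6 * d i) powr CARD('n)) \<partial>count_space C)"
      by (intro hausdorff_content_le_cover C(1))
    also have "\<dots> = (\<integral>\<^sup>+i. ennreal c * emeasure lebesgue (cball i (d i)) \<partial>count_space C)"
    proof (intro nn_integral_cong)
      fix i assume "i \<in> space (count_space C)"
      then have "0 < d i" using d C(2) by auto
      then show "ennreal ((6 * d i) powr CARD('n)) = ennreal c * emeasure lebesgue (cball i (d i))"
        using c by (subst emeasure_lebesgue_cball)
          (auto simp: c_def powr_mult powr_realpow ennreal_mult[symmetric])
    qed
    also have "\<dots> = ennreal c * (\<integral>\<^sup>+i. emeasure lebesgue (cball i (d i)) \<partial>count_space C)"
      by (intro nn_integral_cmult) auto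
    also have "(\<integral>\<^sup>+i. emeasure lebesgue (cball i (d i)) \<partial>count_space C) = emeasure lebesgue (\<Union>i\<in>C. cball i (d i))"
      using C(3) by (intro emeasure_UN_countable[symmetric] C(1))
        (auto simp: disjoint_family_on_def pairwise_def disjnt_def)
    also have "\<dots> \<le> emeasure lebesgue T" using d C(2) by (intro emeasure_mono Tm) blast
    also have "emeasure lebesgue T = emeasure lebesgue (E \<union> (T - E))"
      using T(2) by (intro arg_cong[where f="emeasure lebesgue"]) auto
    also have "\<dots> \<le> emeasure lebesgue E + emeasure lebesgue (T - E)"
      using E Tm by (intro emeasure_subadditive) auto
    also have "\<dots> \<le> emeasure lebesgue E + ennreal (e / c)" using T(3) by (intro add_mono) auto
    finally have "hausdorff_content CARD('n) E \<le> ennreal c * (emeasure lebesgue E + ennreal (e / c))"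
      by (simp add: mult_left_mono)
    also have "\<dots> = ennreal c * emeasure lebesgue E + ennreal e"
      using c e by (simp add: distrib_left ennreal_mult[symmetric])
    finally show "hausdorff_content CARD('n) E \<le> ennreal c * emeasure lebesgue E + ennreal e" .
  qed
  then show ?thesis by (simp add: c_def)
qed

text \<open>A ball of radius \<open>u\<close> meets at most \<open>4\<^sup>n\<close> members of a disjoint family of balls of radius greater
  than \<open>u\<close>: each of them contains a ball of radius \<open>u / 2\<close> inside the concentric ball of radius
  \<open>2 u\<close>. The cardinality is written as a counting measure, so that finiteness of the family is
  part of the conclusion.\<close>

lemma card_large_disjoint_cballs_meeting:
  fixes a :: "'i \<Rightarrow> real ^ 'n"
  assumes C: "countable C" and disj: "pairwise (\<lambda>i j. disjnt (cball (a i) (s i)) (cball (a j) (s j))) C"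
    and u: "0 < u" and D: "\<And>i. i \<in> C \<Longrightarrow> u < s i \<and> ball y u \<inter> cball (a i) (s i) \<noteq> {}"
  shows "emeasure (count_space UNIV) C \<le> ennreal (4 ^ CARD('n))"
proof -
  have "\<exists>z. ball z (u/2) \<subseteq> cball (a i) (s i) \<inter> ball y (2 * u)" if i: "i \<in> C" for i
  proof -
    obtain q where q: "dist y q < u" "dist (a i) q \<le> s i" using D[OF i] by auto
    define l where "l = u / (2 * s i)"
    have s: "u < s i" using D[OF i] by auto
    have l: "0 < l" "l < 1" "l * s i = u / 2" using s u by (auto simp: l_def field_simps)
    \<comment> \<open>\<open>z\<close> lies on the segment from the common point \<open>q\<close> to the centre, at distance at most \<open>u / 2\<close> from \<open>q\<close>\<close>
    define z where "z = q + l *\<^sub>R (a i - q)"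
    have n: "norm (a i - q) \<le> s i" using q by (simp add: dist_norm)
    have "dist q z = l * norm (a i - q)" using l by (simp add: z_def dist_norm)
    also have "\<dots> \<le> l * s i" using l n by (intro mult_left_mono) auto
    finally have 1: "dist q z \<le> u / 2" using l by simp
    have "a i - z = (1 - l) *\<^sub>R (a i - q)" by (simp add: z_def algebra_simps)
    then have "dist (a i) z = (1 - l) * norm (a i - q)" using l by (simp add: dist_norm)
    also have "\<dots> \<le> (1 - l) * s i" using l n by (intro mult_left_mono) auto
    finally have 2: "dist (a i) z \<le> s i - u / 2" using l by (simp add: algebra_simps)
    have "ball z (u/2) \<subseteq> cball (a i) (s i) \<inter> ball y (2 * u)"
    proof
      fix v assume "v \<in> ball z (u/2)"
      then have v: "dist z v < u / 2" by simp
      have "dist (a i) v \<le> dist (a i) z + dist z v" by (rule dist_triangle)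
      moreover have "dist y v \<le> dist y q + (dist q z + dist z v)"
        using dist_triangle[of y v q] dist_triangle[of q v z] by linarith
      ultimately show "v \<in> cball (a i) (s i) \<inter> ball y (2 * u)"
        using v 1 2 q by auto
    qed
    then show ?thesis by blast
  qed
  then obtain z where z: "\<And>i. i \<in> C \<Longrightarrow> ball (z i) (u/2) \<subseteq> cball (a i) (s i) \<inter> ball y (2 * u)"
    by metis
  define \<omega> where "\<omega> = uball TYPE('n) * (u / 2) powr CARD('n)"
  have \<omega>: "0 < \<omega>" using u by (simp add: \<omega>_def)
  have "ennreal \<omega> * emeasure (count_space UNIV) C = (\<integral>\<^sup>+i. ennreal \<omega> \<partial>count_space C)"
    by (simp add: emeasure_count_space)
  also have "\<dots> = (\<integral>\<^sup>+i. emeasure lebesgue (ball (z i) (u/2)) \<partial>count_space C)"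
    using u unfolding \<omega>_def by (subst emeasure_lebesgue_ball) auto
  also have "\<dots> = emeasure lebesgue (\<Union>i\<in>C. ball (z i) (u/2))"
  proof (intro emeasure_UN_countable[symmetric] C(1))
    show "disjoint_family_on (\<lambda>i. ball (z i) (u/2)) C"
      unfolding disjoint_family_on_def
    proof (intro ballI impI)
      fix i j assume "i \<in> C" "j \<in> C" "i \<noteq> j"
      then show "ball (z i) (u/2) \<inter> ball (z j) (u/2) = {}"
        using z[of i] z[of j] disj unfolding pairwise_def disjnt_def by blast
    qed
  qed auto
  also have "\<dots> \<le> emeasure lebesgue (ball y (2 * u))"
    using z by (intro emeasure_mono) auto
  also have "\<dots> = ennreal (\<omega> * 4 ^ CARD('n))"
  proof -
    have "(2 * u) powr CARD('n) = (4 * (u / 2)) powr CARD('n)" by simp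
    also have "\<dots> = 4 powr CARD('n) * (u / 2) powr CARD('n)" by (rule powr_mult)
    finally have eq: "(2 * u) powr CARD('n) = 4 powr CARD('n) * (u / 2) powr CARD('n)" .
    show ?thesis using u unfolding \<omega>_def
      by (subst emeasure_lebesgue_ball, simp, subst eq) (simp add: powr_realpow mult_ac)
  qed
  also have "\<dots> = ennreal \<omega> * ennreal (4 ^ CARD('n))" using \<omega> by (simp add: ennreal_mult)
  finally show ?thesis using \<omega> by (simp add: ennreal_mult_le_mult_iff)
qed

text \<open>Lebesgue measure is bounded by the power \<open>N / \<delta>\<close> of \<open>\<delta>\<close>-dimensional content, since
  \<open>\<Sum> r\<^sub>j powr N \<le> (\<Sum> r\<^sub>j powr \<delta>) powr (N / \<delta>)\<close> for \<open>\<delta> \<le> N\<close>.\<close>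

lemma emeasure_le_cover_powr:
  fixes x :: "nat \<Rightarrow> real ^ 'n"
  assumes \<delta>: "0 < \<delta>" "\<delta> \<le> real CARD('n)" and r: "\<And>j. 0 \<le> r j" and B: "0 \<le> B"
    and F: "F \<subseteq> (\<Union>j\<in>J. ball (x j) (r j))"
    and sum: "csum (\<lambda>j. if j \<in> J then ennreal (r j powr \<delta>) else 0) \<le> ennreal B"
  shows "emeasure lebesgue F \<le> ennreal (uball TYPE('n) * B powr (real CARD('n) / \<delta>))"
proof -
  let ?n = "real CARD('n)"
  define U where "U j = (if j \<in> J then ball (x j) (r j) else {})" for j
  have "emeasure lebesgue F \<le> emeasure lebesgue (\<Union>j. U j)"
    using F by (intro emeasure_mono) (auto simp: U_def)
  also have "\<dots> \<le> (\<Sum>j. emeasure lebesgue (U j))"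
    by (intro emeasure_subadditive_countably) (auto simp: U_def)
  also have "\<dots> = csum (\<lambda>j. emeasure lebesgue (U j))" by (simp add: nn_integral_count_space_nat)
  also have "\<dots> \<le> csum (\<lambda>j. ennreal (uball TYPE('n) * B powr (?n / \<delta> - 1)) * (if j \<in> J then ennreal (r j powr \<delta>) else 0))"
  proof (intro csum_mono)
    fix j
    show "emeasure lebesgue (U j) \<le> ennreal (uball TYPE('n) * B powr (?n / \<delta> - 1)) * (if j \<in> J then ennreal (r j powr \<delta>) else 0)"
    proof (cases "j \<in> J \<and> 0 < r j")
      case False
      then have "U j = {}" by (auto simp: U_def)
      then show ?thesis by simp
    next
      case True
      have "ennreal (r j powr \<delta>) \<le> ennreal B"
        using csum_ge[of "\<lambda>j. if j \<in> J then ennreal (r j powr \<delta>) else 0" j] sum True by auto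
      then have le: "r j powr \<delta> \<le> B" using B by simp
      have "r j powr ?n = (r j powr \<delta>) powr (1 + (?n / \<delta> - 1))"
        using \<delta> by (simp add: powr_powr)
      also have "\<dots> = r j powr \<delta> * (r j powr \<delta>) powr (?n / \<delta> - 1)"
        by (subst powr_mult_base) auto
      also have "\<dots> \<le> r j powr \<delta> * B powr (?n / \<delta> - 1)"
        using le \<delta> by (intro mult_left_mono powr_mono2) auto
      finally have "uball TYPE('n) * r j powr ?n \<le> uball TYPE('n) * (r j powr \<delta> * B powr (?n / \<delta> - 1))"
        by (intro mult_left_mono) auto
      moreover have "emeasure lebesgue (U j) = ennreal (uball TYPE('n) * r j powr ?n)"
        using True unfolding U_def by (subst emeasure_lebesgue_ball[symmetric]) auto
      ultimately show ?thesis using True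
        by (simp add: ennreal_mult[symmetric] mult_ac)
    qed
  qed
  also have "\<dots> \<le> ennreal (uball TYPE('n) * B powr (?n / \<delta> - 1)) * ennreal B"
    unfolding csum_cmult by (intro mult_left_mono sum) auto
  also have "\<dots> = ennreal (uball TYPE('n) * (B * B powr (?n / \<delta> - 1)))"
    using B by (simp add: ennreal_mult[symmetric] mult_ac)
  also have "B * B powr (?n / \<delta> - 1) = B powr (?n / \<delta>)" using B by (subst powr_mult_base) auto
  finally show ?thesis .
qed

section \<open>Pointwise bound for the Riesz potential\<close>

lemma csum_levels_le:
  "csum (\<lambda>k. if ennreal (dy k) < v then ennreal (dy k) else 0) \<le> 2 * v"
proof (cases v)
  case top then show ?thesis by (simp add: ennreal_mult_top)
next
  case (real u)
  show ?thesis
  proof (cases "u = 0")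
    case True
    then have "(if ennreal (dy k) < v then ennreal (dy k) else 0) = 0" for k using real by simp
    then show ?thesis by simp
  next
    case False
    then have u: "0 < u" using real by simp
    have "csum (\<lambda>k. if ennreal (dy k) < v then ennreal (dy k) else 0)
       \<le> csum (\<lambda>k. if dy k \<le> u then ennreal (dy k powr 1) else 0)"
      using real by (intro csum_mono) (auto simp: ennreal_less_iff)
    also have "\<dots> \<le> ennreal (geo 1 * u powr 1)" using u by (intro csum_dy_le) auto
    also have "geo 1 * u powr 1 = 2 * u" using u by (simp add: geo_def powr_minus)
    also have "ennreal (2 * u) = 2 * v" using real u by (simp add: ennreal_mult)
    finally show ?thesis .
  qed
qed

lemma le_csum_levels:
  "v \<le> 2 * csum (\<lambda>k. if ennreal (dy k) < v then ennreal (dy k) else 0)"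
proof (cases v)
  case (real u)
  show ?thesis
  proof (cases "u = 0")
    case True then show ?thesis using real by simp
  next
    case False
    then have "0 < u" using real by simp
    then obtain k where k: "dy k < u" "u \<le> 2 * dy k" by (rule dy_ceiling)
    have "ennreal (dy k) \<le> csum (\<lambda>k. if ennreal (dy k) < v then ennreal (dy k) else 0)"
      using csum_ge[of "\<lambda>k. if ennreal (dy k) < v then ennreal (dy k) else 0" k] k real by (simp add: ennreal_less_iff)
    then have "2 * ennreal (dy k) \<le> 2 * csum (\<lambda>k. if ennreal (dy k) < v then ennreal (dy k) else 0)"
      by (rule mult_left_mono) simp
    moreover have "v \<le> 2 * ennreal (dy k)"
    proof -
      have "v \<le> ennreal (2 * dy k)" using k real by (simp add: ennreal_leI)
      then show ?thesis by (simp add: ennreal_mult)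
    qed
    ultimately show ?thesis by order
  qed
next
  case top
  have ge: "ennreal (dy k) \<le> csum (\<lambda>k. if ennreal (dy k) < v then ennreal (dy k) else 0)" for k
    using csum_ge[of "\<lambda>k. if ennreal (dy k) < v then ennreal (dy k) else 0" k] top by simp
  have "csum (\<lambda>k. if ennreal (dy k) < v then ennreal (dy k) else 0) = top"
  proof (rule ccontr)
    assume "\<not> ?thesis"
    then obtain z where z: "csum (\<lambda>k. if ennreal (dy k) < v then ennreal (dy k) else 0) = ennreal z" "0 \<le> z"
      by (cases "csum (\<lambda>k. if ennreal (dy k) < v then ennreal (dy k) else 0)") auto
    have "0 < z + 1" using z by simp
    then obtain k where "dy k \<le> z + 1" "z + 1 < 2 * dy k" by (rule dy_floor)
    then have "z < dy (k + 1)" by (simp add: dy_add)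
    moreover have "dy (k + 1) \<le> z" using ge[of "k + 1"] z by (simp add: ennreal_le_iff)
    ultimately show False by simp
  qed
  then show ?thesis using top by (simp add: ennreal_mult_top)
qed

text \<open>After Lebesgue measure has replaced the \<open>n\<close>-dimensional content, the kernel and \<open>|f|\<close> are both
  discretized dyadically; the sum on the right is over scales \<open>2\<^sup>m\<close> and levels \<open>2\<^sup>k\<close>. The point
  \<open>y = x\<close>, where the kernel takes a conventional value, is a null set.\<close>

lemma riesz_potential_le:
  fixes f :: "real ^ 'n \<Rightarrow> ereal"
  assumes f: "f \<in> borel_measurable lebesgue" and \<alpha>: "\<alpha> < real CARD('n)"
  defines "E \<equiv> \<lambda>k. {y. ennreal (dy k) < e2ennreal \<bar>f y\<bar>}"
  shows "riesz_potential (real CARD('n)) \<alpha> f x \<le>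
    ennreal (8 * (6 ^ CARD('n) / uball TYPE('n)) * 2 powr (real CARD('n) - \<alpha>)) *
    csum (\<lambda>m. ennreal (dy m powr (\<alpha> - real CARD('n))) * csum (\<lambda>k. ennreal (dy k) * emeasure lebesgue (E k \<inter> cball x (dy m))))"
proof -
  let ?n = "real CARD('n)"
  define C where "C = 6 ^ CARD('n) / uball TYPE('n)"
  have C: "0 < C" by (simp add: C_def)
  define F where "F y = e2ennreal \<bar>f y\<bar>" for y
  have F [measurable]: "F \<in> borel_measurable lebesgue" using f unfolding F_def by measurable
  define b where "b = ?n - \<alpha>"
  have b: "0 < b" using \<alpha> by (simp add: b_def)
  define g where "g y = F y / ennreal (norm (x - y) powr b)" for y
  have nm: "(\<lambda>y. norm (x - y) powr b) \<in> borel_measurable lebesgue"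
    by (intro measurable_completion) measurable
  have g [measurable]: "g \<in> borel_measurable lebesgue"
    unfolding g_def using nm by measurable
  have Em [measurable]: "E k \<in> sets lebesgue" for k
  proof -
    have "E k = {y \<in> space lebesgue. ennreal (dy k) < F y}" by (simp add: E_def F_def)
    also have "\<dots> \<in> sets lebesgue" by measurable
    finally show ?thesis .
  qed
  have gm [measurable]: "{y. ennreal t < g y} \<in> sets lebesgue" for t
  proof -
    have "{y. ennreal t < g y} = {y \<in> space lebesgue. ennreal t < g y}" by simp
    also have "\<dots> \<in> sets lebesgue" by measurable
    finally show ?thesis .
  qed
  define I where "I m k = (indicator (E k \<inter> cball x (dy m)) :: _ \<Rightarrow> ennreal)" for m k
  define S where "S y = csum (\<lambda>m. ennreal (dy m powr (- b)) * csum (\<lambda>k. ennreal (dy k) * I m k y))" for y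
  have pt: "g y \<le> ennreal (2 powr b * 2) * S y" if y: "y \<noteq> x" for y
  proof -
    define D where "D = norm (x - y)"
    have D: "0 < D" using y by (simp add: D_def)
    then obtain m' where m': "dy m' < D" "D \<le> 2 * dy m'" by (rule dy_ceiling)
    define m where "m = m' + 1"
    have m: "D \<le> dy m" "dy m < 2 * D" using m' by (auto simp: m_def dy_add)
    have "g y = F y * ennreal (D powr (- b))"
      using D by (simp add: g_def D_def[symmetric] divide_ennreal_def inverse_ennreal powr_minus)
    also have "D powr (- b) \<le> (dy m / 2) powr (- b)" using m b D by (intro powr_mono2') auto
    also have "(dy m / 2) powr (- b) = 2 powr b * dy m powr (- b)"
      by (simp add: powr_divide powr_minus field_simps)
    finally have "g y \<le> F y * ennreal (2 powr b * dy m powr (- b))"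
      by (simp add: mult_left_mono ennreal_leI)
    also have "\<dots> \<le> (2 * csum (\<lambda>k. if ennreal (dy k) < F y then ennreal (dy k) else 0)) * ennreal (2 powr b * dy m powr (- b))"
      by (intro mult_right_mono le_csum_levels) auto
    also have "csum (\<lambda>k. if ennreal (dy k) < F y then ennreal (dy k) else 0) = csum (\<lambda>k. ennreal (dy k) * I m k y)"
    proof (intro nn_integral_cong)
      fix k
      have "y \<in> cball x (dy m)" using m by (simp add: D_def dist_norm)
      then show "(if ennreal (dy k) < F y then ennreal (dy k) else 0) = ennreal (dy k) * I m k y"
        by (auto simp: I_def E_def F_def indicator_def)
    qed
    also have "(2 * csum (\<lambda>k. ennreal (dy k) * I m k y)) * ennreal (2 powr b * dy m powr (- b))
       = ennreal (2 powr b * 2) * (ennreal (dy m powr (- b)) * csum (\<lambda>k. ennreal (dy k) * I m k y))"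
      by (simp add: ennreal_mult mult_ac)
    also have "\<dots> \<le> ennreal (2 powr b * 2) * S y"
      unfolding S_def using csum_ge[of "\<lambda>m. ennreal (dy m powr (- b)) * csum (\<lambda>k. ennreal (dy k) * I m k y)" m]
      by (intro mult_left_mono) auto
    finally show ?thesis .
  qed
  have Im [measurable]: "I m k \<in> borel_measurable lebesgue" for m k
    unfolding I_def by (intro borel_measurable_indicator) auto
  have Skm: "(\<lambda>y. csum (\<lambda>k. ennreal (dy k) * I m k y)) \<in> borel_measurable lebesgue" for m
    by (rule borel_measurable_csum) simp_all
  have "(\<integral>\<^sup>+y. g y \<partial>lebesgue) \<le> (\<integral>\<^sup>+y. ennreal (2 powr b * 2) * S y \<partial>lebesgue)"
  proof (rule nn_integral_mono_AE)
    have "AE y in lebesgue. y \<notin> {x}" by (intro AE_not_in) (simp add: null_sets_completionI)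
    then show "AE y in lebesgue. g y \<le> ennreal (2 powr b * 2) * S y"
      by eventually_elim (use pt in auto)
  qed
  also have "\<dots> = ennreal (2 powr b * 2) * (\<integral>\<^sup>+y. S y \<partial>lebesgue)"
    unfolding S_def using Skm by (intro nn_integral_cmult borel_measurable_csum) auto
  also have "(\<integral>\<^sup>+y. S y \<partial>lebesgue) = csum (\<lambda>m. ennreal (dy m powr (- b)) * csum (\<lambda>k. ennreal (dy k) * emeasure lebesgue (E k \<inter> cball x (dy m))))"
  proof -
    have "(\<integral>\<^sup>+y. S y \<partial>lebesgue) = csum (\<lambda>m. \<integral>\<^sup>+y. ennreal (dy m powr (- b)) * csum (\<lambda>k. ennreal (dy k) * I m k y) \<partial>lebesgue)"
      unfolding S_def using Skm by (intro nn_integral_csum borel_measurable_times_ennreal) auto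
    also have "\<dots> = csum (\<lambda>m. ennreal (dy m powr (- b)) * (\<integral>\<^sup>+y. csum (\<lambda>k. ennreal (dy k) * I m k y) \<partial>lebesgue))"
      using Skm by (intro nn_integral_cong nn_integral_cmult) auto
    also have "\<dots> = csum (\<lambda>m. ennreal (dy m powr (- b)) * csum (\<lambda>k. \<integral>\<^sup>+y. ennreal (dy k) * I m k y \<partial>lebesgue))"
      by (subst nn_integral_csum) auto
    also have "\<dots> = csum (\<lambda>m. ennreal (dy m powr (- b)) * csum (\<lambda>k. ennreal (dy k) * emeasure lebesgue (E k \<inter> cball x (dy m))))"
      unfolding I_def by (subst nn_integral_cmult_indicator) auto
    finally show ?thesis .
  qed
  finally have int: "(\<integral>\<^sup>+y. g y \<partial>lebesgue) \<le> ennreal (2 powr b * 2) *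
     csum (\<lambda>m. ennreal (dy m powr (- b)) * csum (\<lambda>k. ennreal (dy k) * emeasure lebesgue (E k \<inter> cball x (dy m))))" .
  have "riesz_potential ?n \<alpha> f x = (\<integral>\<^sup>+t\<in>{0<..}. hausdorff_content ?n {y. ennreal t < g y} \<partial>lborel)"
    by (simp add: riesz_potential_def choquet_integral_def g_def F_def b_def)
  also have "\<dots> \<le> csum (\<lambda>k. ennreal (1 * dy (k + 1) powr 1) * hausdorff_content ?n {y. ennreal (1 * dy k powr 1) < g y})"
    by (intro nn_integral_antimono_le_csum hausdorff_content_mono) (auto intro: le_less_trans[OF ennreal_leI])
  also have "\<dots> \<le> csum (\<lambda>k. ennreal (2 * C) * (\<integral>\<^sup>+y. (if ennreal (dy k) < g y then ennreal (dy k) else 0) \<partial>lebesgue))"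
  proof (rule csum_mono)
    fix k
    have "ennreal (dy k) * emeasure lebesgue {y. ennreal (dy k) < g y} = (\<integral>\<^sup>+y. ennreal (dy k) * indicator {y. ennreal (dy k) < g y} y \<partial>lebesgue)"
      by (subst nn_integral_cmult_indicator) auto
    also have "\<dots> = (\<integral>\<^sup>+y. (if ennreal (dy k) < g y then ennreal (dy k) else 0) \<partial>lebesgue)"
      by (intro nn_integral_cong) (auto simp: indicator_def)
    finally have eq: "ennreal (dy k) * emeasure lebesgue {y. ennreal (dy k) < g y} = (\<integral>\<^sup>+y. (if ennreal (dy k) < g y then ennreal (dy k) else 0) \<partial>lebesgue)" .
    have "ennreal (2 * dy k) * hausdorff_content ?n {y. ennreal (dy k) < g y} \<le> ennreal (2 * dy k) * (ennreal C * emeasure lebesgue {y. ennreal (dy k) < g y})"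
      unfolding C_def by (intro mult_left_mono hausdorff_content_le_lebesgue gm) auto
    also have "\<dots> = ennreal (2 * C) * (ennreal (dy k) * emeasure lebesgue {y. ennreal (dy k) < g y})"
      using C by (simp add: ennreal_mult mult_ac)
    finally show "ennreal (1 * dy (k + 1) powr 1) * hausdorff_content ?n {y. ennreal (1 * dy k powr 1) < g y}
      \<le> ennreal (2 * C) * (\<integral>\<^sup>+y. (if ennreal (dy k) < g y then ennreal (dy k) else 0) \<partial>lebesgue)"
      unfolding eq by (simp add: dy_add mult.commute)
  qed
  also have "\<dots> = ennreal (2 * C) * (\<integral>\<^sup>+y. csum (\<lambda>k. if ennreal (dy k) < g y then ennreal (dy k) else 0) \<partial>lebesgue)"
    unfolding csum_cmult by (subst nn_integral_csum) auto
  also have "\<dots> \<le> ennreal (2 * C) * (\<integral>\<^sup>+y. 2 * g y \<partial>lebesgue)"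
    by (intro mult_left_mono nn_integral_mono csum_levels_le) auto
  also have "(\<integral>\<^sup>+y. 2 * g y \<partial>lebesgue) = 2 * (\<integral>\<^sup>+y. g y \<partial>lebesgue)"
    by (intro nn_integral_cmult g)
  also have "ennreal (2 * C) * (2 * (\<integral>\<^sup>+y. g y \<partial>lebesgue)) \<le> ennreal (2 * C) * (2 * (ennreal (2 powr b * 2) *
     csum (\<lambda>m. ennreal (dy m powr (- b)) * csum (\<lambda>k. ennreal (dy k) * emeasure lebesgue (E k \<inter> cball x (dy m))))))"
    by (intro mult_left_mono int) auto
  also have "\<dots> = (ennreal (2 * C) * (ennreal 2 * ennreal (2 powr b * 2))) *
     csum (\<lambda>m. ennreal (dy m powr (- b)) * csum (\<lambda>k. ennreal (dy k) * emeasure lebesgue (E k \<inter> cball x (dy m))))"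
    by (simp add: mult.assoc)
  also have "ennreal (2 * C) * (ennreal 2 * ennreal (2 powr b * 2)) = ennreal (2 * C * (2 * (2 powr b * 2)))"
    using C by (subst (1 2) ennreal_mult) auto
  also have "2 * C * (2 * (2 powr b * 2)) = 8 * C * 2 powr b" by simp
  finally show ?thesis by (simp add: C_def b_def)
qed

section \<open>The capacitary estimate from covers of the level sets\<close>

text \<open>The constants of the estimates below. They depend on the exponents and on the dimension \<open>N\<close>
  only: \<open>scale_const\<close> multiplies the threshold for the potential, \<open>content_const\<close> bounds the
  content of the set where the threshold is exceeded.\<close>

definition scale_const :: "real \<Rightarrow> real \<Rightarrow> real \<Rightarrow> real \<Rightarrow> real \<Rightarrow> real" where
  "scale_const N \<delta> \<alpha> lam p = (geo 1 + geo (p * N / \<delta> - 1)) * unit_ball_vol N * geo (\<delta> / p - \<alpha>)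
     + (geo 1 * unit_ball_vol N + 1) * geo (\<alpha> - lam)"

definition content_const :: "real \<Rightarrow> real \<Rightarrow> real \<Rightarrow> real \<Rightarrow> real" where
  "content_const N \<delta> lam p0 = 3 powr (\<delta> - lam * p0)
     + 6 powr (\<delta> - lam * p0) * ((geo 1 + geo (p0 * N / \<delta> - 1)) * unit_ball_vol N) powr p0 * 4 powr N"

lemma less_ennreal_powrD:
  assumes v: "0 \<le> v" and q: "0 < q" and less: "ennreal (v powr q) < ennreal_powr a q"
  shows "ennreal v < a"
proof (cases a)
  case (real b)
  then have "v powr q < b powr q" using less by (simp add: ennreal_powr_def ennreal_less_iff)
  then have "v < b" using powr_mono2[of q b v] q real by (cases "b \<le> v") auto
  then show ?thesis using real v by (simp add: ennreal_less_iff)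
qed simp

text \<open>The sets \<open>E k\<close> stand for the superlevel sets \<open>{|f| > 2\<^sup>k}\<close>; each comes with a cover by balls, in which
  a radius \<open>0\<close> marks an unused index. The number \<open>w powr p\<close> bounds the resulting dyadic
  form of \<open>\<integral>|f| powr p\<close> with respect to \<open>\<delta>\<close>-dimensional content. The target dimension of the theorem,
  \<open>\<delta> - \<kappa> p\<close>, is \<open>\<delta> - lam * p0\<close> here: an auxiliary exponent \<open>p0 < p\<close>, still above \<open>\<delta> / n\<close>, leaves
  room for summation over scales, and \<open>lam = \<kappa> p / p0\<close> is still below \<open>\<alpha>\<close>.\<close>

locale level_covers =
  fixes \<delta> \<alpha> lam p p0 w :: real
    and E :: "int \<Rightarrow> (real ^ 'n) set"
    and x :: "int \<Rightarrow> nat \<Rightarrow> real ^ 'n"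
    and r :: "int \<Rightarrow> nat \<Rightarrow> real"
  assumes \<delta>: "0 < \<delta>" "\<delta> \<le> real CARD('n)"
    and \<alpha>: "0 < \<alpha>" and lam: "0 \<le> lam" "lam < \<alpha>"
    and p0: "\<delta> / real CARD('n) < p0" "p0 < p" and p: "p < \<delta> / \<alpha>"
    and w: "0 < w"
    and E_cover: "\<And>k. E k \<subseteq> (\<Union>j. ball (x k j) (r k j))"
    and r_nonneg: "\<And>k j. 0 \<le> r k j"
    and sum_le: "csum (\<lambda>k. ennreal (dy k powr p) * csum (\<lambda>j. ennreal (r k j powr \<delta>))) \<le> ennreal (w powr p)"
begin

text \<open>The sum \<open>h k\<close> of the cover of \<open>E k\<close> bounds its \<open>\<delta>\<close>-dimensional content. For the scale \<open>\<rho> = 2\<^sup>M\<close>, the base level is \<open>s M = w * \<rho> powr (- \<delta> / p)\<close>. At a smaller scale \<open>2\<^sup>m\<close> the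
  cut-off level is raised to \<open>thr M m\<close>; because \<open>lam < \<alpha>\<close>, values below the cut-off
  contribute at most a multiple of \<open>w * \<rho> powr (- \<beta>)\<close> to the potential.\<close>

abbreviation h :: "int \<Rightarrow> ennreal" where "h k \<equiv> csum (\<lambda>j. ennreal (r k j powr \<delta>))"
abbreviation \<beta> :: real where "\<beta> \<equiv> \<delta> / p - \<alpha>"
abbreviation s :: "int \<Rightarrow> real" where "s M \<equiv> w * dy M powr (- (\<delta> / p))"
abbreviation thr :: "int \<Rightarrow> int \<Rightarrow> real" where "thr M m \<equiv> s M * (dy M / dy m) powr lam"

text \<open>The Lebesgue measure of the level set \<open>E k\<close> in the closed ball of radius \<open>2\<^sup>m\<close> around \<open>y\<close>.\<close>

definition mass :: "int \<Rightarrow> real ^ 'n \<Rightarrow> int \<Rightarrow> ennreal" where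
  "mass m y k = emeasure lebesgue (E k \<inter> cball y (dy m))"

text \<open>The dyadic form of the Riesz potential of order \<open>\<alpha>\<close>.\<close>

definition potential :: "real ^ 'n \<Rightarrow> ennreal" where
  "potential y = csum (\<lambda>m. ennreal (dy m powr (\<alpha> - real CARD('n))) * csum (\<lambda>k. ennreal (dy k) * mass m y k))"

text \<open>Threefold dilates of those covering balls that are cheap at scale \<open>\<rho> = 2\<^sup>M\<close>: their level is so high
  relative to their radius that the power \<open>\<delta> - lam * p0\<close> of the radius is controlled by
  \<open>\<rho> powr (- lam * p0) * (2\<^sup>k / s M) powr p0 * (r k j) powr \<delta>\<close>.\<close>

definition big_balls :: "int \<Rightarrow> (real ^ 'n) set" where
  "big_balls M = (\<Union>(k, j) \<in> {(k, j). s M \<le> dy k \<and> s M * (dy M / r k j) powr lam \<le> dy k}. ball (x k j) (3 * r k j))"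

text \<open>Centres \<open>y\<close> and scales \<open>2\<^sup>m \<le> 2\<^sup>M\<close> at which the average of the values above the cut-off exceeds
  the cut-off, while all covering balls of those levels near \<open>y\<close> are smaller than the scale.\<close>

definition crowded :: "int \<Rightarrow> ((real ^ 'n) \<times> int) set" where
  "crowded M = {(y, m). m \<le> M \<and>
     ennreal (thr M m * dy m powr real CARD('n)) < csum (\<lambda>k. if thr M m \<le> dy k then ennreal (dy k) * mass m y k else 0) \<and>
     (\<forall>k j. thr M m \<le> dy k \<longrightarrow> ball (x k j) (r k j) \<inter> cball y (dy m) \<noteq> {} \<longrightarrow> r k j < dy m)}"

text \<open>The sum of \<open>2 powr (k p0) * h k\<close> over the levels \<open>2\<^sup>k \<ge> s M\<close>.\<close>

definition tail :: "int \<Rightarrow> ennreal" where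
  "tail M = csum (\<lambda>k. if s M \<le> dy k then ennreal (dy k powr p0) * h k else 0)"

lemma params_pos: "0 < p0" "0 < p" "0 < real CARD('n)" "0 < s M" "0 < thr M m" "0 < \<beta>"
proof -
  show N: "0 < real CARD('n)" by simp
  have "0 < \<delta> / real CARD('n)" using \<delta> N by (intro divide_pos_pos)
  then show p0': "0 < p0" using p0 by linarith
  then show p': "0 < p" using p0 by linarith
  show s: "0 < s M" using w by simp
  then show "0 < thr M m" by simp
  show "0 < \<beta>" using p \<alpha> p' by (simp add: field_simps)
qed

lemma s_le_thr: "m \<le> M \<Longrightarrow> s M \<le> thr M m"
proof -
  assume "m \<le> M"
  then have "1 \<le> dy M / dy m" by (simp add: field_simps)
  then have "1 \<le> (dy M / dy m) powr lam" using lam by (intro ge_one_powr_ge_zero) auto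
  then show ?thesis using params_pos(4)[of M] mult_left_mono[of 1 "(dy M / dy m) powr lam" "s M"] by simp
qed

lemma s_dy: "s M * dy M powr \<alpha> = w * dy M powr (- \<beta>)"
  by (simp add: powr_add[symmetric])

lemma mass_le_ball: "mass m y k \<le> ennreal (uball TYPE('n) * dy m powr real CARD('n))"
proof -
  have "mass m y k \<le> emeasure lebesgue (cball y (dy m))"
    unfolding mass_def by (intro emeasure_mono) auto
  then show ?thesis by (subst (asm) emeasure_lebesgue_cball) auto
qed

lemma mass_le_powr:
  assumes "0 \<le> B" and "csum (\<lambda>j. if ball (x k j) (r k j) \<inter> cball y (dy m) \<noteq> {} then ennreal (r k j powr \<delta>) else 0) \<le> ennreal B"
  shows "mass m y k \<le> ennreal (uball TYPE('n) * B powr (real CARD('n) / \<delta>))"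
  unfolding mass_def
proof (rule emeasure_le_cover_powr[OF \<delta> r_nonneg assms(1)])
  show "E k \<inter> cball y (dy m) \<subseteq> (\<Union>j\<in>{j. ball (x k j) (r k j) \<inter> cball y (dy m) \<noteq> {}}. ball (x k j) (r k j))"
    using E_cover[of k] by blast
  show "csum (\<lambda>j. if j \<in> {j. ball (x k j) (r k j) \<inter> cball y (dy m) \<noteq> {}} then ennreal (r k j powr \<delta>) else 0) \<le> ennreal B"
    using assms(2) by simp
qed

text \<open>The bound used at the scales above \<open>2\<^sup>M\<close>. It needs only the weak-type information
  \<open>h k \<le> (w / 2\<^sup>k) powr p\<close>.\<close>

lemma large_scale:
  "csum (\<lambda>k. ennreal (dy k) * mass m y k) \<le> ennreal ((geo 1 + geo (p * real CARD('n) / \<delta> - 1)) * uball TYPE('n) * dy m powr real CARD('n) * (w powr p * dy m powr (- \<delta>)) powr (1 / p))"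
proof (rule csum_dyadic_min_le[OF \<delta>(1) _ params_pos(3)])
  show "\<delta> / real CARD('n) < p" using p0 by linarith
  show "mass m y k \<le> ennreal (uball TYPE('n) * dy m powr real CARD('n))" for k by (rule mass_le_ball)
  show "mass m y k \<le> ennreal (uball TYPE('n) * (w powr p * dy k powr (- p)) powr (real CARD('n) / \<delta>))" for k
  proof (rule mass_le_powr)
    have "ennreal (dy k powr p) * h k \<le> ennreal (w powr p)"
      using csum_ge[of "\<lambda>k. ennreal (dy k powr p) * h k" k] sum_le by (rule order_trans)
    then have "ennreal (dy k powr (- p)) * (ennreal (dy k powr p) * h k) \<le> ennreal (dy k powr (- p)) * ennreal (w powr p)"
      by (intro mult_left_mono) auto
    moreover have "ennreal (dy k powr (- p)) * (ennreal (dy k powr p) * h k) = h k"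
      by (simp add: mult.assoc[symmetric] ennreal_mult[symmetric] powr_add[symmetric])
    ultimately have "h k \<le> ennreal (w powr p * dy k powr (- p))"
      by (simp add: ennreal_mult[symmetric] mult.commute)
    moreover have "csum (\<lambda>j. if ball (x k j) (r k j) \<inter> cball y (dy m) \<noteq> {} then ennreal (r k j powr \<delta>) else 0) \<le> h k"
      by (intro csum_mono) auto
    ultimately show "csum (\<lambda>j. if ball (x k j) (r k j) \<inter> cball y (dy m) \<noteq> {} then ennreal (r k j powr \<delta>) else 0)
       \<le> ennreal (w powr p * dy k powr (- p))" by order
  qed simp
qed auto

text \<open>Outside the two exceptional sets the average at a scale \<open>2\<^sup>m \<le> 2\<^sup>M\<close> is comparable to the cut-off
  level. If it were not, then \<open>(y, m)\<close> would be crowded, unless some covering ball near \<open>y\<close> has radius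
  \<open>\<ge> 2\<^sup>m\<close>; such a ball is cheap, and its dilate contains \<open>y\<close>.\<close>

lemma small_scale:
  assumes m: "m \<le> M" and y: "y \<notin> big_balls M" "y \<notin> fst ` crowded M"
  shows "csum (\<lambda>k. ennreal (dy k) * mass m y k) \<le> ennreal ((geo 1 * uball TYPE('n) + 1) * dy m powr real CARD('n) * thr M m)"
proof -
  let ?D = "csum (\<lambda>k. if thr M m \<le> dy k then ennreal (dy k) * mass m y k else 0)"
  have D: "?D \<le> ennreal (thr M m * dy m powr real CARD('n))"
  proof (rule ccontr)
    assume neg: "\<not> ?thesis"
    have "r k j < dy m" if k: "thr M m \<le> dy k" and meet: "ball (x k j) (r k j) \<inter> cball y (dy m) \<noteq> {}" for k j
    proof (rule ccontr)
      assume "\<not> r k j < dy m"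
      then have le: "dy m \<le> r k j" by simp
      obtain q where q: "dist (x k j) q < r k j" "dist y q \<le> dy m" using meet by auto
      have "dist (x k j) y \<le> dist (x k j) q + dist y q"
        using dist_triangle[of "x k j" y q] by (simp add: dist_commute)
      then have "dist (x k j) y < 3 * r k j" using q le dy_pos[of m] by linarith
      moreover have "s M \<le> dy k" using s_le_thr[OF m] k by linarith
      moreover have "s M * (dy M / r k j) powr lam \<le> dy k"
      proof -
        have "(dy M / r k j) powr lam \<le> (dy M / dy m) powr lam"
          using le lam less_le_trans[OF dy_pos le] by (intro powr_mono2 divide_left_mono) auto
        then have "s M * (dy M / r k j) powr lam \<le> thr M m" using w by (intro mult_left_mono) auto
        then show ?thesis using k by linarith
      qed
      ultimately have "y \<in> big_balls M" unfolding big_balls_def by (auto intro!: bexI[of _ "(k, j)"])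
      then show False using y by simp
    qed
    then have "(y, m) \<in> crowded M" using m neg unfolding crowded_def by auto
    then show False using y by force
  qed
  have "csum (\<lambda>k. ennreal (dy k) * mass m y k) \<le>
     csum (\<lambda>k. ennreal (uball TYPE('n) * dy m powr real CARD('n)) * (if dy k \<le> thr M m then ennreal (dy k powr 1) else 0)
       + (if thr M m \<le> dy k then ennreal (dy k) * mass m y k else 0))"
  proof (rule csum_mono)
    fix k
    show "ennreal (dy k) * mass m y k \<le> ennreal (uball TYPE('n) * dy m powr real CARD('n)) * (if dy k \<le> thr M m then ennreal (dy k powr 1) else 0)
       + (if thr M m \<le> dy k then ennreal (dy k) * mass m y k else 0)"
    proof (cases "thr M m \<le> dy k")
      case False
      then show ?thesis using mult_left_mono[OF mass_le_ball, of "ennreal (dy k)" m y k] by (simp add: mult.commute)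
    qed simp
  qed
  also have "\<dots> \<le> ennreal (uball TYPE('n) * dy m powr real CARD('n)) * ennreal (geo 1 * thr M m powr 1) + ennreal (thr M m * dy m powr real CARD('n))"
    unfolding csum_add csum_cmult using params_pos(5)[of M m]
    by (intro add_mono mult_left_mono csum_dy_le D) auto
  also have "\<dots> = ennreal (uball TYPE('n) * dy m powr real CARD('n) * (geo 1 * thr M m powr 1) + thr M m * dy m powr real CARD('n))"
    using geo_pos[of 1] params_pos(5)[of M m] by (simp add: ennreal_mult'[symmetric] flip: ennreal_plus)
  also have "uball TYPE('n) * dy m powr real CARD('n) * (geo 1 * thr M m powr 1) + thr M m * dy m powr real CARD('n) = (geo 1 * uball TYPE('n) + 1) * dy m powr real CARD('n) * thr M m"
    using params_pos(5)[of M m] by (simp add: algebra_simps)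
  finally show ?thesis .
qed


lemma geo_consts_pos: "0 < geo 1" "0 < geo \<beta>" "0 < geo (\<alpha> - lam)" "0 < geo (p * real CARD('n) / \<delta> - 1)" "0 < geo (p0 * real CARD('n) / \<delta> - 1)"
proof -
  have "\<delta> < p0 * real CARD('n)" "\<delta> < p * real CARD('n)" using p0 params_pos(3) by (auto simp: field_simps intro: less_trans)
  then show "0 < geo (p * real CARD('n) / \<delta> - 1)" "0 < geo (p0 * real CARD('n) / \<delta> - 1)" using \<delta> by (auto intro!: geo_pos simp: field_simps)
  show "0 < geo 1" "0 < geo \<beta>" "0 < geo (\<alpha> - lam)" using params_pos(6) lam by (auto intro!: geo_pos)
qed

lemma potential_le:
  assumes y: "y \<notin> big_balls M" "y \<notin> fst ` crowded M"
  shows "potential y \<le> ennreal (scale_const (real CARD('n)) \<delta> \<alpha> lam p * w * dy M powr (- \<beta>))"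
proof -
  define c1 where "c1 = (geo 1 + geo (p * real CARD('n) / \<delta> - 1)) * uball TYPE('n) * w"
  define c2 where "c2 = (geo 1 * uball TYPE('n) + 1) * s M * dy M powr lam"
  have c: "0 < c1" "0 < c2" using geo_consts_pos w uball_pos[where 'n='n] by (auto simp: c1_def c2_def intro!: mult_pos_pos add_pos_pos)
  have "potential y \<le> csum (\<lambda>m. ennreal c1 * (if dy M \<le> dy m then ennreal (dy m powr (- \<beta>)) else 0)
      + ennreal c2 * (if dy m \<le> dy M then ennreal (dy m powr (\<alpha> - lam)) else 0))"
    unfolding potential_def
  proof (rule csum_mono)
    fix m
    show "ennreal (dy m powr (\<alpha> - real CARD('n))) * csum (\<lambda>k. ennreal (dy k) * mass m y k)
      \<le> ennreal c1 * (if dy M \<le> dy m then ennreal (dy m powr (- \<beta>)) else 0)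
      + ennreal c2 * (if dy m \<le> dy M then ennreal (dy m powr (\<alpha> - lam)) else 0)"
    proof (cases "m \<le> M")
      case True
      have "ennreal (dy m powr (\<alpha> - real CARD('n))) * csum (\<lambda>k. ennreal (dy k) * mass m y k)
         \<le> ennreal (dy m powr (\<alpha> - real CARD('n))) * ennreal ((geo 1 * uball TYPE('n) + 1) * dy m powr real CARD('n) * thr M m)"
        by (intro mult_left_mono small_scale[OF True y]) auto
      also have "\<dots> = ennreal (dy m powr (\<alpha> - real CARD('n)) * ((geo 1 * uball TYPE('n) + 1) * dy m powr real CARD('n) * thr M m))"
        by (simp add: ennreal_mult')
      also have "dy m powr (\<alpha> - real CARD('n)) * ((geo 1 * uball TYPE('n) + 1) * dy m powr real CARD('n) * thr M m) = c2 * (dy m powr (\<alpha> - real CARD('n)) * dy m powr real CARD('n) * dy m powr (- lam))"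
        by (simp add: c2_def powr_divide powr_minus field_simps)
      also have "dy m powr (\<alpha> - real CARD('n)) * dy m powr real CARD('n) * dy m powr (- lam) = dy m powr (\<alpha> - lam)"
        by (simp add: powr_add[symmetric])
      also have "ennreal (c2 * dy m powr (\<alpha> - lam)) = ennreal c2 * ennreal (dy m powr (\<alpha> - lam))"
        using c by (simp add: ennreal_mult)
      finally have *: "ennreal (dy m powr (\<alpha> - real CARD('n))) * csum (\<lambda>k. ennreal (dy k) * mass m y k) \<le> ennreal c2 * ennreal (dy m powr (\<alpha> - lam))" .
      show ?thesis using add_mono[OF zero_le *] True by simp
    next
      case False
      have "ennreal (dy m powr (\<alpha> - real CARD('n))) * csum (\<lambda>k. ennreal (dy k) * mass m y k)
         \<le> ennreal (dy m powr (\<alpha> - real CARD('n))) * ennreal ((geo 1 + geo (p * real CARD('n) / \<delta> - 1)) * uball TYPE('n) * dy m powr real CARD('n) * (w powr p * dy m powr (- \<delta>)) powr (1 / p))"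
        by (intro mult_left_mono large_scale) auto
      also have "\<dots> = ennreal (dy m powr (\<alpha> - real CARD('n)) * ((geo 1 + geo (p * real CARD('n) / \<delta> - 1)) * uball TYPE('n) * dy m powr real CARD('n) * (w powr p * dy m powr (- \<delta>)) powr (1 / p)))"
        by (simp add: ennreal_mult')
      also have "(w powr p * dy m powr (- \<delta>)) powr (1 / p) = w * dy m powr (- (\<delta> / p))"
        using w params_pos(2) by (simp add: powr_mult powr_powr)
      also have "dy m powr (\<alpha> - real CARD('n)) * ((geo 1 + geo (p * real CARD('n) / \<delta> - 1)) * uball TYPE('n) * dy m powr real CARD('n) * (w * dy m powr (- (\<delta> / p))))
         = c1 * (dy m powr (\<alpha> - real CARD('n)) * dy m powr real CARD('n) * dy m powr (- (\<delta> / p)))"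
        by (simp add: c1_def mult_ac)
      also have "dy m powr (\<alpha> - real CARD('n)) * dy m powr real CARD('n) * dy m powr (- (\<delta> / p)) = dy m powr (- \<beta>)"
        by (simp add: powr_add[symmetric])
      also have "ennreal (c1 * dy m powr (- \<beta>)) = ennreal c1 * ennreal (dy m powr (- \<beta>))"
        using c by (simp add: ennreal_mult)
      finally show ?thesis using False by simp
    qed
  qed
  also have "\<dots> \<le> ennreal c1 * ennreal (geo \<beta> * dy M powr (- \<beta>)) + ennreal c2 * ennreal (geo (\<alpha> - lam) * dy M powr (\<alpha> - lam))"
    unfolding csum_add csum_cmult using params_pos(6) lam
    by (intro add_mono mult_left_mono csum_dy_le csum_dy_ge) auto
  also have "\<dots> = ennreal (c1 * (geo \<beta> * dy M powr (- \<beta>)) + c2 * (geo (\<alpha> - lam) * dy M powr (\<alpha> - lam)))"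
    using c geo_consts_pos by (simp add: ennreal_mult[symmetric] flip: ennreal_plus)
  also have "c2 * (geo (\<alpha> - lam) * dy M powr (\<alpha> - lam)) = (geo 1 * uball TYPE('n) + 1) * geo (\<alpha> - lam) * (s M * (dy M powr lam * dy M powr (\<alpha> - lam)))"
    by (simp add: c2_def mult_ac)
  also have "dy M powr lam * dy M powr (\<alpha> - lam) = dy M powr \<alpha>" by (simp add: powr_add[symmetric])
  also have "c1 * (geo \<beta> * dy M powr (- \<beta>)) + (geo 1 * uball TYPE('n) + 1) * geo (\<alpha> - lam) * (s M * dy M powr \<alpha>) = scale_const (real CARD('n)) \<delta> \<alpha> lam p * w * dy M powr (- \<beta>)"
    unfolding s_dy c1_def scale_const_def by (simp add: algebra_simps)
  finally show ?thesis .
qed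

lemma content_big_balls:
  "hausdorff_content (\<delta> - lam * p0) (big_balls M) \<le> ennreal (3 powr (\<delta> - lam * p0) * dy M powr (- lam * p0) * s M powr (- p0)) * tail M"
proof -
  define c where "c = 3 powr (\<delta> - lam * p0) * dy M powr (- lam * p0) * s M powr (- p0)"
  define Q where "Q k j \<longleftrightarrow> s M \<le> dy k \<and> s M * (dy M / r k j) powr lam \<le> dy k" for k j
  define R where "R = (\<lambda>(k, j). if Q k j then 3 * r k j else 0)"
  have "big_balls M \<subseteq> (\<Union>i. ball ((\<lambda>(k, j). x k j) i) (R i))"
  proof
    fix y assume "y \<in> big_balls M"
    then obtain k j where "Q k j" "y \<in> ball (x k j) (3 * r k j)" unfolding big_balls_def Q_def by auto
    then have "y \<in> ball ((\<lambda>(k, j). x k j) (k, j)) (R (k, j))" by (simp add: R_def)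
    then show "y \<in> (\<Union>i. ball ((\<lambda>(k, j). x k j) i) (R i))" by blast
  qed
  then have "hausdorff_content (\<delta> - lam * p0) (big_balls M) \<le> csum (\<lambda>i. ennreal (R i powr (\<delta> - lam * p0)))"
    by (intro hausdorff_content_le_cover) auto
  also have "\<dots> = csum (\<lambda>k. csum (\<lambda>j. ennreal (R (k, j) powr (\<delta> - lam * p0))))"
    by (rule nn_integral_fst_count_space[symmetric])
  also have "\<dots> \<le> csum (\<lambda>k. ennreal c * (if s M \<le> dy k then ennreal (dy k powr p0) * h k else 0))"
  proof (rule csum_mono)
    fix k
    show "csum (\<lambda>j. ennreal (R (k, j) powr (\<delta> - lam * p0))) \<le> ennreal c * (if s M \<le> dy k then ennreal (dy k powr p0) * h k else 0)"
    proof (cases "s M \<le> dy k")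
      case False then show ?thesis by (simp add: R_def Q_def)
    next
      case True
      have "csum (\<lambda>j. ennreal (R (k, j) powr (\<delta> - lam * p0))) \<le> csum (\<lambda>j. ennreal (c * dy k powr p0) * ennreal (r k j powr \<delta>))"
      proof (rule csum_mono)
        fix j
        show "ennreal (R (k, j) powr (\<delta> - lam * p0)) \<le> ennreal (c * dy k powr p0) * ennreal (r k j powr \<delta>)"
        proof (cases "Q k j \<and> 0 < r k j")
          case False then show ?thesis using r_nonneg[of k j] by (auto simp: R_def)
        next
          case True
          then have r: "0 < r k j" and q: "s M * (dy M / r k j) powr lam \<le> dy k" by (auto simp: Q_def)
          have "(s M * (dy M / r k j) powr lam) powr p0 \<le> dy k powr p0"
            using q params_pos(1) w by (intro powr_mono2) auto
          moreover have "(s M * (dy M / r k j) powr lam) powr p0 = s M powr p0 * (dy M powr (lam * p0) * r k j powr (- lam * p0))"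
            using r by (simp add: powr_mult powr_divide powr_powr powr_minus field_simps)
          ultimately have *: "s M powr p0 * (dy M powr (lam * p0) * r k j powr (- lam * p0)) \<le> dy k powr p0" by simp
          have cc: "c * (s M powr p0 * dy M powr (lam * p0)) = 3 powr (\<delta> - lam * p0)"
            using params_pos(4)[of M] by (simp add: c_def powr_minus field_simps)
          have "R (k, j) powr (\<delta> - lam * p0) = 3 powr (\<delta> - lam * p0) * r k j powr (\<delta> - lam * p0)"
            using True by (simp add: R_def powr_mult)
          also have "r k j powr (\<delta> - lam * p0) = r k j powr \<delta> * r k j powr (- lam * p0)"
            by (simp add: powr_add[symmetric])
          also have "3 powr (\<delta> - lam * p0) * (r k j powr \<delta> * r k j powr (- lam * p0)) =
            c * (s M powr p0 * (dy M powr (lam * p0) * r k j powr (- lam * p0))) * r k j powr \<delta>"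
            unfolding cc[symmetric] by (simp add: mult_ac)
          also have "\<dots> \<le> c * dy k powr p0 * r k j powr \<delta>"
            using * by (intro mult_right_mono mult_left_mono) (auto simp: c_def)
          finally show ?thesis by (simp add: ennreal_mult''[symmetric] ennreal_leI)
        qed
      qed
      also have "\<dots> = ennreal c * (ennreal (dy k powr p0) * h k)"
        unfolding csum_cmult by (simp add: ennreal_mult'' mult.assoc)
      finally show ?thesis using True by simp
    qed
  qed
  also have "\<dots> = ennreal c * tail M" unfolding csum_cmult tail_def ..
  finally show ?thesis by (simp add: c_def)
qed

lemma tail_finite: "tail M < top"
proof -
  have "tail M \<le> csum (\<lambda>k. ennreal (s M powr (p0 - p)) * (ennreal (dy k powr p) * h k))"
    unfolding tail_def
  proof (rule csum_mono)
    fix k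
    show "(if s M \<le> dy k then ennreal (dy k powr p0) * h k else 0) \<le> ennreal (s M powr (p0 - p)) * (ennreal (dy k powr p) * h k)"
    proof (cases "s M \<le> dy k")
      case True
      have "dy k powr p0 = dy k powr (p0 - p) * dy k powr p" by (simp add: powr_add[symmetric])
      also have "\<dots> \<le> s M powr (p0 - p) * dy k powr p"
        using True params_pos(4)[of M] p0 by (intro mult_right_mono powr_mono2') auto
      finally have "ennreal (dy k powr p0) * h k \<le> ennreal (s M powr (p0 - p) * dy k powr p) * h k"
        by (intro mult_right_mono ennreal_leI) auto
      then show ?thesis using True by (simp add: ennreal_mult' mult.assoc)
    qed simp
  qed
  also have "\<dots> \<le> ennreal (s M powr (p0 - p)) * ennreal (w powr p)"
    unfolding csum_cmult by (intro mult_left_mono sum_le) auto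
  also have "\<dots> < top" by (simp add: ennreal_mult[symmetric])
  finally show ?thesis .
qed

text \<open>At a crowded point the covering balls met by the ball are all small, so their \<open>\<delta>\<close>-powers bound the
  level measures inside it; the dyadic summation lemma with the exponent \<open>p0\<close> turns the large average into a
  bound for the radius.\<close>

lemma crowded_radius_le:
  assumes i: "(y, m) \<in> crowded M"
  defines "A \<equiv> csum (\<lambda>k. if s M \<le> dy k then ennreal (dy k powr p0) *
      csum (\<lambda>j. if ball (x k j) (r k j) \<inter> cball y (dy m) \<noteq> {} \<and> r k j < dy m then ennreal (r k j powr \<delta>) else 0) else 0)"
  shows "ennreal (dy m powr (\<delta> - lam * p0)) \<le>
    ennreal (((geo 1 + geo (p0 * real CARD('n) / \<delta> - 1)) * uball TYPE('n)) powr p0 * dy M powr (- lam * p0) * s M powr (- p0)) * A"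
proof -
  define L where "L = (geo 1 + geo (p0 * real CARD('n) / \<delta> - 1)) * uball TYPE('n)"
  have L: "0 < L" using geo_consts_pos uball_pos[where 'n='n] by (auto simp: L_def intro!: mult_pos_pos add_pos_pos)
  from i have m: "m \<le> M"
    and D: "ennreal (thr M m * dy m powr real CARD('n)) < csum (\<lambda>k. if thr M m \<le> dy k then ennreal (dy k) * mass m y k else 0)"
    and small: "\<And>k j. thr M m \<le> dy k \<Longrightarrow> ball (x k j) (r k j) \<inter> cball y (dy m) \<noteq> {} \<Longrightarrow> r k j < dy m"
    unfolding crowded_def by auto
  have "A \<le> tail M"
    unfolding A_def tail_def by (intro csum_mono) (auto intro!: mult_left_mono csum_mono)
  then have "A < top" using tail_finite by (rule le_less_trans)
  then obtain B where B: "A = ennreal B" "0 \<le> B" by (cases A) auto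
  have "csum (\<lambda>k. if thr M m \<le> dy k then ennreal (dy k) * mass m y k else 0)
      = csum (\<lambda>k. ennreal (dy k) * (if thr M m \<le> dy k then mass m y k else 0))"
    by (intro nn_integral_cong) auto
  also have "\<dots> \<le> ennreal ((geo 1 + geo (p0 * real CARD('n) / \<delta> - 1)) * uball TYPE('n) * dy m powr real CARD('n) * (B * dy m powr (- \<delta>)) powr (1 / p0))"
  proof (rule csum_dyadic_min_le[OF \<delta>(1) p0(1) params_pos(3) dy_pos B(2) uball_pos])
    show "(if thr M m \<le> dy k then mass m y k else 0) \<le> ennreal (uball TYPE('n) * dy m powr real CARD('n))" for k
      using mass_le_ball[of m y k] by auto
    show "(if thr M m \<le> dy k then mass m y k else 0) \<le> ennreal (uball TYPE('n) * (B * dy k powr (- p0)) powr (real CARD('n) / \<delta>))" for k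
    proof (cases "thr M m \<le> dy k")
      case True
      have sk: "s M \<le> dy k" using s_le_thr[OF m] True by linarith
      let ?S = "csum (\<lambda>j. if ball (x k j) (r k j) \<inter> cball y (dy m) \<noteq> {} then ennreal (r k j powr \<delta>) else 0)"
      have "?S = csum (\<lambda>j. if ball (x k j) (r k j) \<inter> cball y (dy m) \<noteq> {} \<and> r k j < dy m then ennreal (r k j powr \<delta>) else 0)"
        using small[OF True] by (intro nn_integral_cong) auto
      then have "ennreal (dy k powr p0) * ?S \<le> ennreal B"
        unfolding B(1)[symmetric] A_def
        using csum_ge[of "\<lambda>k. if s M \<le> dy k then ennreal (dy k powr p0) *
          csum (\<lambda>j. if ball (x k j) (r k j) \<inter> cball y (dy m) \<noteq> {} \<and> r k j < dy m then ennreal (r k j powr \<delta>) else 0) else 0" k] sk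
        by simp
      then have "ennreal (dy k powr (- p0)) * (ennreal (dy k powr p0) * ?S) \<le> ennreal (dy k powr (- p0)) * ennreal B"
        by (intro mult_left_mono) auto
      moreover have "ennreal (dy k powr (- p0)) * (ennreal (dy k powr p0) * ?S) = ?S"
        by (simp add: mult.assoc[symmetric] ennreal_mult[symmetric] powr_add[symmetric])
      ultimately have "?S \<le> ennreal (B * dy k powr (- p0))"
        using B by (simp add: ennreal_mult[symmetric] mult.commute)
      then have "mass m y k \<le> ennreal (uball TYPE('n) * (B * dy k powr (- p0)) powr (real CARD('n) / \<delta>))"
        using B by (intro mass_le_powr) auto
      then show ?thesis using True by simp
    qed simp
  qed
  finally have "ennreal (thr M m * dy m powr real CARD('n)) < ennreal (L * dy m powr real CARD('n) * (B * dy m powr (- \<delta>)) powr (1 / p0))"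
    using D unfolding L_def by order
  then have "thr M m * dy m powr real CARD('n) < L * dy m powr real CARD('n) * (B * dy m powr (- \<delta>)) powr (1 / p0)"
    using params_pos(5)[of M m] by (subst (asm) ennreal_less_iff) auto
  then have "dy m powr real CARD('n) * thr M m < dy m powr real CARD('n) * (L * (B * dy m powr (- \<delta>)) powr (1 / p0))"
    by (simp add: mult_ac)
  then have "thr M m \<le> L * (B * dy m powr (- \<delta>)) powr (1 / p0)"
    by (subst (asm) mult_less_cancel_left_pos) auto
  then have "thr M m powr p0 \<le> (L * (B * dy m powr (- \<delta>)) powr (1 / p0)) powr p0"
    using params_pos(1) params_pos(5)[of M m] by (intro powr_mono2) auto
  also have "\<dots> = L powr p0 * (B * dy m powr (- \<delta>))"
    using L B params_pos(1) by (simp add: powr_mult powr_powr powr_one_gt_zero_iff)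
  finally have *: "thr M m powr p0 \<le> L powr p0 * (B * dy m powr (- \<delta>))" .
  have thr: "thr M m powr p0 = s M powr p0 * (dy M powr (lam * p0) * dy m powr (- lam * p0))"
    by (simp add: powr_mult powr_divide powr_powr powr_minus field_simps)
  define c where "c = dy M powr (- lam * p0) * s M powr (- p0)"
  have c0: "0 \<le> c" by (simp add: c_def)
  have cc: "c * (s M powr p0 * dy M powr (lam * p0)) = 1"
    using params_pos(4)[of M] by (simp add: c_def powr_minus field_simps)
  have "dy m powr (\<delta> - lam * p0) = dy m powr \<delta> * dy m powr (- lam * p0)"
    by (simp add: powr_add[symmetric])
  also have "\<dots> = (c * (s M powr p0 * dy M powr (lam * p0))) * (dy m powr \<delta> * dy m powr (- lam * p0))" by (simp add: cc)
  also have "\<dots> = c * (dy m powr \<delta> * thr M m powr p0)" unfolding thr by (simp add: mult_ac)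
  also have "\<dots> \<le> c * (dy m powr \<delta> * (L powr p0 * (B * dy m powr (- \<delta>))))"
    by (intro mult_left_mono * c0) auto
  also have "\<dots> = L powr p0 * c * B * (dy m powr \<delta> * dy m powr (- \<delta>))" by (simp add: mult_ac)
  also have "dy m powr \<delta> * dy m powr (- \<delta>) = 1" by (simp add: powr_add[symmetric])
  finally have "dy m powr (\<delta> - lam * p0) \<le> L powr p0 * c * B" by simp
  then have "ennreal (dy m powr (\<delta> - lam * p0)) \<le> ennreal (L powr p0 * c) * ennreal B"
    using B by (simp add: ennreal_mult''[symmetric] ennreal_leI)
  then show ?thesis unfolding B(1)[symmetric] L_def c_def by (simp add: mult.assoc)
qed

text \<open>Sums of content over disjoint balls are not additive in general. Here they are controlled
  since each covering ball enters only for crowded balls larger than itself, hence for at most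
  \<open>4\<^sup>n\<close> balls of the disjoint Vitali subfamily.\<close>

lemma content_crowded:
  "hausdorff_content (\<delta> - lam * p0) (fst ` crowded M) \<le>
    ennreal (6 powr (\<delta> - lam * p0) * (((geo 1 + geo (p0 * real CARD('n) / \<delta> - 1)) * uball TYPE('n)) powr p0 * dy M powr (- lam * p0) * s M powr (- p0)) * 4 ^ CARD('n)) * tail M"
proof -
  define c where "c = ((geo 1 + geo (p0 * real CARD('n) / \<delta> - 1)) * uball TYPE('n)) powr p0 * dy M powr (- lam * p0) * s M powr (- p0)"
  have c0: "0 \<le> c" by (simp add: c_def)
  define a where "a = (fst :: (real ^ 'n) \<times> int \<Rightarrow> real ^ 'n)"
  define t where "t = (\<lambda>i :: (real ^ 'n) \<times> int. dy (snd i))"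
  have sub: "fst ` crowded M \<subseteq> (\<Union>i\<in>crowded M. cball (a i) (t i))"
    by (force simp: a_def t_def)
  have bd: "0 < t i \<and> t i \<le> dy M" if "i \<in> crowded M" for i using that by (auto simp: t_def crowded_def)
  obtain C where C: "countable C" "C \<subseteq> crowded M" "pairwise (\<lambda>i j. disjnt (cball (a i) (t i)) (cball (a j) (t j))) C"
     "fst ` crowded M \<subseteq> (\<Union>i\<in>C. cball (a i) (5 * t i))"
    by (rule Vitali_covering_lemma_cballs[OF sub bd])
  define P where "P k j i \<longleftrightarrow> ball (x k j) (r k j) \<inter> cball (a i) (t i) \<noteq> {} \<and> r k j < t i" for k j i
  have over: "(\<integral>\<^sup>+i. (if P k j i then ennreal (r k j powr \<delta>) else 0) \<partial>count_space C) \<le> ennreal (4 ^ CARD('n)) * ennreal (r k j powr \<delta>)" for k j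
  proof (cases "0 < r k j")
    case False
    then have "r k j = 0" using r_nonneg[of k j] by simp
    then have "(if P k j i then ennreal (r k j powr \<delta>) else 0) = 0" for i by simp
    then show ?thesis by simp
  next
    case True
    define C' where "C' = {i \<in> C. P k j i}"
    have "(\<integral>\<^sup>+i. (if P k j i then ennreal (r k j powr \<delta>) else 0) \<partial>count_space C)
        = (\<integral>\<^sup>+i. ennreal (r k j powr \<delta>) * indicator C' i \<partial>count_space C)"
      by (intro nn_integral_cong) (auto simp: C'_def indicator_def)
    also have "\<dots> = ennreal (r k j powr \<delta>) * emeasure (count_space C) C'"
      by (subst nn_integral_cmult_indicator) (auto simp: C'_def)
    also have "emeasure (count_space C) C' = emeasure (count_space UNIV) C'"
      by (auto simp: emeasure_count_space C'_def)
    also have "\<dots> \<le> ennreal (4 ^ CARD('n))"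
    proof (rule card_large_disjoint_cballs_meeting[OF _ _ True, of C' a t "x k j"])
      show "countable C'" using C(1) by (auto simp: C'_def)
      show "pairwise (\<lambda>i j. disjnt (cball (a i) (t i)) (cball (a j) (t j))) C'"
        using C(3) by (rule pairwise_subset) (auto simp: C'_def)
    qed (auto simp: C'_def P_def)
    finally show ?thesis by (simp add: mult.commute mult_right_mono)
  qed
  have "fst ` crowded M \<subseteq> (\<Union>i\<in>C. ball (a i) (6 * t i))"
  proof
    fix y assume "y \<in> fst ` crowded M"
    then obtain i where i: "i \<in> C" "dist (a i) y \<le> 5 * t i" using C(4) by auto
    moreover have "0 < t i" by (simp add: t_def)
    ultimately show "y \<in> (\<Union>i\<in>C. ball (a i) (6 * t i))" by (auto intro!: bexI[of _ i])
  qed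
  then have "hausdorff_content (\<delta> - lam * p0) (fst ` crowded M) \<le> (\<integral>\<^sup>+i. ennreal ((6 * t i) powr (\<delta> - lam * p0)) \<partial>count_space C)"
    by (intro hausdorff_content_le_cover C(1))
  also have "\<dots> \<le> (\<integral>\<^sup>+i. ennreal (6 powr (\<delta> - lam * p0) * c) *
      csum (\<lambda>k. if s M \<le> dy k then ennreal (dy k powr p0) * csum (\<lambda>j. if P k j i then ennreal (r k j powr \<delta>) else 0) else 0) \<partial>count_space C)"
  proof (intro nn_integral_mono)
    fix i assume "i \<in> space (count_space C)"
    then have "(a i, snd i) \<in> crowded M" using C(2) by (auto simp: a_def)
    from crowded_radius_le[OF this]
    have "ennreal (t i powr (\<delta> - lam * p0)) \<le> ennreal c *
      csum (\<lambda>k. if s M \<le> dy k then ennreal (dy k powr p0) * csum (\<lambda>j. if P k j i then ennreal (r k j powr \<delta>) else 0) else 0)"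
      unfolding P_def t_def c_def .
    then have "ennreal (6 powr (\<delta> - lam * p0)) * ennreal (t i powr (\<delta> - lam * p0)) \<le> ennreal (6 powr (\<delta> - lam * p0)) * (ennreal c *
      csum (\<lambda>k. if s M \<le> dy k then ennreal (dy k powr p0) * csum (\<lambda>j. if P k j i then ennreal (r k j powr \<delta>) else 0) else 0))"
      by (intro mult_left_mono) auto
    then show "ennreal ((6 * t i) powr (\<delta> - lam * p0)) \<le> ennreal (6 powr (\<delta> - lam * p0) * c) *
      csum (\<lambda>k. if s M \<le> dy k then ennreal (dy k powr p0) * csum (\<lambda>j. if P k j i then ennreal (r k j powr \<delta>) else 0) else 0)"
      by (simp add: powr_mult ennreal_mult' mult.assoc)
  qed
  also have "\<dots> = ennreal (6 powr (\<delta> - lam * p0) * c) *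
      csum (\<lambda>k. if s M \<le> dy k then ennreal (dy k powr p0) * csum (\<lambda>j. \<integral>\<^sup>+i. (if P k j i then ennreal (r k j powr \<delta>) else 0) \<partial>count_space C) else 0)"
  proof -
    have "(\<integral>\<^sup>+i. csum (\<lambda>k. if s M \<le> dy k then ennreal (dy k powr p0) * csum (\<lambda>j. if P k j i then ennreal (r k j powr \<delta>) else 0) else 0) \<partial>count_space C)
        = csum (\<lambda>k. \<integral>\<^sup>+i. (if s M \<le> dy k then ennreal (dy k powr p0) * csum (\<lambda>j. if P k j i then ennreal (r k j powr \<delta>) else 0) else 0) \<partial>count_space C)"
      by (rule nn_integral_csum) simp
    also have "\<dots> = csum (\<lambda>k. if s M \<le> dy k then ennreal (dy k powr p0) * csum (\<lambda>j. \<integral>\<^sup>+i. (if P k j i then ennreal (r k j powr \<delta>) else 0) \<partial>count_space C) else 0)"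
    proof (intro nn_integral_cong)
      fix k
      show "(\<integral>\<^sup>+i. (if s M \<le> dy k then ennreal (dy k powr p0) * csum (\<lambda>j. if P k j i then ennreal (r k j powr \<delta>) else 0) else 0) \<partial>count_space C)
        = (if s M \<le> dy k then ennreal (dy k powr p0) * csum (\<lambda>j. \<integral>\<^sup>+i. (if P k j i then ennreal (r k j powr \<delta>) else 0) \<partial>count_space C) else 0)"
      proof (cases "s M \<le> dy k")
        case True
        have "(\<integral>\<^sup>+i. ennreal (dy k powr p0) * csum (\<lambda>j. if P k j i then ennreal (r k j powr \<delta>) else 0) \<partial>count_space C)
          = ennreal (dy k powr p0) * (\<integral>\<^sup>+i. csum (\<lambda>j. if P k j i then ennreal (r k j powr \<delta>) else 0) \<partial>count_space C)"
          by (intro nn_integral_cmult) simp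
        also have "(\<integral>\<^sup>+i. csum (\<lambda>j. if P k j i then ennreal (r k j powr \<delta>) else 0) \<partial>count_space C)
          = csum (\<lambda>j. \<integral>\<^sup>+i. (if P k j i then ennreal (r k j powr \<delta>) else 0) \<partial>count_space C)"
          by (rule nn_integral_csum) simp
        finally show ?thesis using True by simp
      qed simp
    qed
    finally show ?thesis by (subst nn_integral_cmult) auto
  qed
  also have "\<dots> \<le> ennreal (6 powr (\<delta> - lam * p0) * c) * csum (\<lambda>k. ennreal (4 ^ CARD('n)) * (if s M \<le> dy k then ennreal (dy k powr p0) * h k else 0))"
  proof (intro mult_left_mono csum_mono)
    fix k
    have "csum (\<lambda>j. \<integral>\<^sup>+i. (if P k j i then ennreal (r k j powr \<delta>) else 0) \<partial>count_space C) \<le> csum (\<lambda>j. ennreal (4 ^ CARD('n)) * ennreal (r k j powr \<delta>))"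
      by (intro csum_mono over)
    also have "\<dots> = ennreal (4 ^ CARD('n)) * h k" by (rule csum_cmult)
    finally have "ennreal (dy k powr p0) * csum (\<lambda>j. \<integral>\<^sup>+i. (if P k j i then ennreal (r k j powr \<delta>) else 0) \<partial>count_space C)
       \<le> ennreal (dy k powr p0) * (ennreal (4 ^ CARD('n)) * h k)" by (intro mult_left_mono) auto
    then show "(if s M \<le> dy k then ennreal (dy k powr p0) * csum (\<lambda>j. \<integral>\<^sup>+i. (if P k j i then ennreal (r k j powr \<delta>) else 0) \<partial>count_space C) else 0)
       \<le> ennreal (4 ^ CARD('n)) * (if s M \<le> dy k then ennreal (dy k powr p0) * h k else 0)"
      by (simp add: mult.left_commute)
  qed simp
  also have "\<dots> = ennreal (6 powr (\<delta> - lam * p0) * c * 4 ^ CARD('n)) * tail M"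
    unfolding csum_cmult tail_def using c0 by (simp add: ennreal_mult'' mult.assoc)
  finally show ?thesis unfolding c_def .
qed

text \<open>The capacitary estimate at the scale \<open>2\<^sup>M\<close>.\<close>

lemma content_superlevel_potential:
  "hausdorff_content (\<delta> - lam * p0) {y. ennreal (scale_const (real CARD('n)) \<delta> \<alpha> lam p * w * dy M powr (- \<beta>)) < potential y}
    \<le> ennreal (content_const (real CARD('n)) \<delta> lam p0 * dy M powr (- lam * p0) * s M powr (- p0)) * tail M"
proof -
  let ?d = "\<delta> - lam * p0"
  define b where "b = dy M powr (- lam * p0) * s M powr (- p0)"
  define L where "L = 6 powr ?d * ((geo 1 + geo (p0 * real CARD('n) / \<delta> - 1)) * uball TYPE('n)) powr p0 * 4 ^ CARD('n)"
  have L: "0 \<le> L" "0 \<le> b" by (simp_all add: L_def b_def)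
  have "{y. ennreal (scale_const (real CARD('n)) \<delta> \<alpha> lam p * w * dy M powr (- \<beta>)) < potential y} \<subseteq> big_balls M \<union> fst ` crowded M"
  proof (rule subsetI, rule ccontr)
    fix y assume y: "y \<in> {y. ennreal (scale_const (real CARD('n)) \<delta> \<alpha> lam p * w * dy M powr (- \<beta>)) < potential y}"
      and "y \<notin> big_balls M \<union> fst ` crowded M"
    then have "potential y \<le> ennreal (scale_const (real CARD('n)) \<delta> \<alpha> lam p * w * dy M powr (- \<beta>))"
      by (intro potential_le) simp_all
    with y show False by (simp add: leD)
  qed
  then have "hausdorff_content ?d {y. ennreal (scale_const (real CARD('n)) \<delta> \<alpha> lam p * w * dy M powr (- \<beta>)) < potential y}
     \<le> hausdorff_content ?d (big_balls M \<union> fst ` crowded M)" by (rule hausdorff_content_mono)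
  also have "\<dots> \<le> hausdorff_content ?d (big_balls M) + hausdorff_content ?d (fst ` crowded M)"
    by (rule hausdorff_content_Un)
  also have "\<dots> \<le> ennreal (3 powr ?d * b) * tail M + ennreal (L * b) * tail M"
    using content_big_balls[of M] content_crowded[of M] unfolding b_def L_def
    by (intro add_mono) (simp_all add: mult_ac)
  also have "\<dots> = ennreal (content_const (real CARD('n)) \<delta> lam p0 * b) * tail M"
  proof -
    have "content_const (real CARD('n)) \<delta> lam p0 = 3 powr ?d + L"
      by (simp add: content_const_def L_def powr_realpow)
    then have "ennreal (content_const (real CARD('n)) \<delta> lam p0 * b) = ennreal (3 powr ?d * b) + ennreal (L * b)"
      using L by (simp add: distrib_right)
    then show ?thesis by (simp add: distrib_right)
  qed
  finally show ?thesis by (simp add: b_def mult.assoc)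
qed

text \<open>Exchanging the sums over scales and levels; the sum over the scales with \<open>s M \<le> 2\<^sup>k\<close> is geometric with
  the positive exponent \<open>\<eta>\<close>, because \<open>p0 < p\<close>.\<close>

lemma csum_tail_le:
  defines "\<eta> \<equiv> \<delta> * (1 - p0 / p)"
  shows "csum (\<lambda>M. ennreal (dy M powr (- \<eta>)) * tail M) \<le> ennreal (geo \<eta> * w powr p0)"
proof -
  have \<eta>: "0 < \<eta>" using \<delta> p0 params_pos(2) by (simp add: \<eta>_def)
  have e1: "\<eta> * (p / \<delta>) = p - p0" using \<delta> params_pos(2) by (simp add: \<eta>_def field_simps)
  have iff: "s M \<le> dy k \<longleftrightarrow> (w / dy k) powr (p / \<delta>) \<le> dy M" for M k
  proof -
    have "s M \<le> dy k \<longleftrightarrow> w / dy k \<le> dy M powr (\<delta> / p)" using w by (simp add: powr_minus field_simps)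
    also have "\<dots> \<longleftrightarrow> (w / dy k) powr (p / \<delta>) \<le> (dy M powr (\<delta> / p)) powr (p / \<delta>)"
    proof -
      have 1: "0 < w / dy k" "0 < dy M powr (\<delta> / p)" "0 < p / \<delta>" using w \<delta> params_pos(2) by auto
      show ?thesis
        using powr_mono2[of "p / \<delta>" "w / dy k" "dy M powr (\<delta> / p)"]
          powr_less_mono2[of "p / \<delta>" "dy M powr (\<delta> / p)" "w / dy k"] 1
        by (meson less_imp_le not_less)
    qed
    also have "(dy M powr (\<delta> / p)) powr (p / \<delta>) = dy M" using \<delta> params_pos(2) by (simp add: powr_powr)
    finally show ?thesis .
  qed
  have "csum (\<lambda>M. ennreal (dy M powr (- \<eta>)) * tail M)
      = csum (\<lambda>M. csum (\<lambda>k. ennreal (dy M powr (- \<eta>)) * (if s M \<le> dy k then ennreal (dy k powr p0) * h k else 0)))"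
    unfolding tail_def csum_cmult ..
  also have "\<dots> = csum (\<lambda>k. csum (\<lambda>M. ennreal (dy M powr (- \<eta>)) * (if s M \<le> dy k then ennreal (dy k powr p0) * h k else 0)))"
    by (rule csum_swap)
  also have "\<dots> = csum (\<lambda>k. csum (\<lambda>M. ennreal (dy k powr p0) * h k * (if (w / dy k) powr (p / \<delta>) \<le> dy M then ennreal (dy M powr (- \<eta>)) else 0)))"
    by (intro nn_integral_cong) (auto simp: iff mult_ac)
  also have "\<dots> \<le> csum (\<lambda>k. ennreal (dy k powr p0) * h k * ennreal (geo \<eta> * ((w / dy k) powr (p / \<delta>)) powr (- \<eta>)))"
    unfolding csum_cmult using w by (intro csum_mono mult_left_mono csum_dy_ge \<eta>) auto
  also have "\<dots> = csum (\<lambda>k. ennreal (geo \<eta> * w powr (p0 - p)) * (ennreal (dy k powr p) * h k))"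
  proof (intro nn_integral_cong)
    fix k
    have "((w / dy k) powr (p / \<delta>)) powr (- \<eta>) = (w / dy k) powr (p0 - p)"
    proof -
      have "p / \<delta> * - \<eta> = p0 - p" using e1 by (simp add: mult.commute)
      then show ?thesis by (simp only: powr_powr)
    qed
    also have "\<dots> = w powr (p0 - p) * dy k powr (p - p0)"
      using w by (simp add: powr_divide powr_diff field_simps)
    finally have "dy k powr p0 * (geo \<eta> * ((w / dy k) powr (p / \<delta>)) powr (- \<eta>)) = geo \<eta> * w powr (p0 - p) * (dy k powr p0 * dy k powr (p - p0))"
      by simp
    also have "dy k powr p0 * dy k powr (p - p0) = dy k powr p" by (simp add: powr_add[symmetric])
    finally have eq: "dy k powr p0 * (geo \<eta> * ((w / dy k) powr (p / \<delta>)) powr (- \<eta>)) = geo \<eta> * w powr (p0 - p) * dy k powr p" .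
    have "ennreal (dy k powr p0) * h k * ennreal (geo \<eta> * ((w / dy k) powr (p / \<delta>)) powr (- \<eta>))
       = ennreal (dy k powr p0 * (geo \<eta> * ((w / dy k) powr (p / \<delta>)) powr (- \<eta>))) * h k"
      by (subst ennreal_mult') (auto simp: mult_ac)
    also have "\<dots> = ennreal (geo \<eta> * w powr (p0 - p)) * (ennreal (dy k powr p) * h k)"
      unfolding eq by (subst ennreal_mult'') (auto simp: mult_ac)
    finally show "ennreal (dy k powr p0) * h k * ennreal (geo \<eta> * ((w / dy k) powr (p / \<delta>)) powr (- \<eta>))
       = ennreal (geo \<eta> * w powr (p0 - p)) * (ennreal (dy k powr p) * h k)" .
  qed
  also have "\<dots> \<le> ennreal (geo \<eta> * w powr (p0 - p)) * ennreal (w powr p)"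
    unfolding csum_cmult by (intro mult_left_mono sum_le) auto
  also have "\<dots> = ennreal (geo \<eta> * (w powr (p0 - p) * w powr p))"
    by (simp add: ennreal_mult''[symmetric] mult.assoc)
  also have "w powr (p0 - p) * w powr p = w powr p0" by (simp add: powr_add[symmetric])
  finally show ?thesis .
qed

text \<open>The thresholds \<open>2 powr (- M \<beta>)\<close> of the capacitary estimate, raised to the power \<open>q\<close>, form the dyadic
  sequence for which the layer-cake sum has to be evaluated, since \<open>q \<beta> = \<delta> - lam * p0\<close>.\<close>

lemma choquet_integral_le:
  fixes g :: "real ^ 'n \<Rightarrow> ennreal"
  assumes C0: "0 < C0" and g: "\<And>y. g y \<le> ennreal C0 * potential y"
    and d: "0 < \<delta> - lam * p0" and q: "q = (\<delta> - lam * p0) / \<beta>"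
  shows "choquet_integral (\<delta> - lam * p0) UNIV (\<lambda>y. ennreal_powr (g y) q)
    \<le> ennreal ((C0 * scale_const (real CARD('n)) \<delta> \<alpha> lam p) powr q * 2 powr (\<delta> - lam * p0)
        * content_const (real CARD('n)) \<delta> lam p0 * geo (\<delta> * (1 - p0 / p)) * w powr q)"
proof -
  let ?d = "\<delta> - lam * p0" and ?K = "scale_const (real CARD('n)) \<delta> \<alpha> lam p" and ?Q = "content_const (real CARD('n)) \<delta> lam p0"
  define \<eta> where "\<eta> = \<delta> * (1 - p0 / p)"
  have K: "0 < ?K" using geo_consts_pos uball_pos[where 'n='n] unfolding scale_const_def
    by (intro add_pos_pos mult_pos_pos) auto
  have Q: "0 \<le> ?Q" by (simp add: content_const_def)
  have q0: "0 < q" using q d params_pos(6) by simp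
  have qb: "\<beta> * q = ?d" using q params_pos(6) by simp
  define c where "c = (C0 * ?K * w) powr q"
  have c: "0 < c" using C0 K w by (simp add: c_def)
  define H where "H t = hausdorff_content ?d {y. ennreal t < ennreal_powr (g y) q}" for t :: real
  have anti: "H t \<le> H u" if "0 < u" "u \<le> t" for t u
    unfolding H_def using that by (intro hausdorff_content_mono) (auto intro: le_less_trans[OF ennreal_leI])
  have HM: "H (c * dy (- M) powr ?d) \<le> ennreal (?Q * dy M powr (- lam * p0) * s M powr (- p0)) * tail M" for M
  proof -
    have eq: "c * dy (- M) powr ?d = (C0 * (?K * w * dy M powr (- \<beta>))) powr q"
    proof -
      have "dy (- M) powr ?d = (dy M powr (- \<beta>)) powr q"
      proof -
        have "(dy M powr (- \<beta>)) powr q = dy M powr (- ?d)"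
          by (simp only: powr_powr mult_minus_left qb)
        also have "\<dots> = dy (- M) powr ?d" by (simp only: dy_minus powr_divide powr_one_eq_one powr_minus_divide)
        finally show ?thesis ..
      qed
      then show ?thesis using C0 K w by (simp add: c_def powr_mult mult_ac)
    qed
    have "{y. ennreal (c * dy (- M) powr ?d) < ennreal_powr (g y) q} \<subseteq> {y. ennreal (?K * w * dy M powr (- \<beta>)) < potential y}"
    proof
      fix y assume "y \<in> {y. ennreal (c * dy (- M) powr ?d) < ennreal_powr (g y) q}"
      then have "ennreal (C0 * (?K * w * dy M powr (- \<beta>))) < g y"
        unfolding eq mem_Collect_eq using C0 K w by (rule_tac less_ennreal_powrD[OF _ q0]) simp_all
      also have "g y \<le> ennreal C0 * potential y" by (rule g)
      finally have less: "ennreal C0 * ennreal (?K * w * dy M powr (- \<beta>)) < ennreal C0 * potential y"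
        using C0 by (simp add: ennreal_mult')
      show "y \<in> {y. ennreal (?K * w * dy M powr (- \<beta>)) < potential y}"
      proof (rule CollectI, rule ccontr)
        assume "\<not> ennreal (?K * w * dy M powr (- \<beta>)) < potential y"
        then have "potential y \<le> ennreal (?K * w * dy M powr (- \<beta>))" by (simp only: not_less)
        then have "ennreal C0 * potential y \<le> ennreal C0 * ennreal (?K * w * dy M powr (- \<beta>))"
          by (rule mult_left_mono) simp
        with less show False by (meson leD)
      qed
    qed
    then have "H (c * dy (- M) powr ?d) \<le> hausdorff_content ?d {y. ennreal (?K * w * dy M powr (- \<beta>)) < potential y}"
      unfolding H_def by (rule hausdorff_content_mono)
    also note content_superlevel_potential
    finally show ?thesis .
  qed
  \<comment> \<open>high levels correspond to small scales, whence the change of sign of the index\<close>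
  have bij: "bij_betw (uminus :: int \<Rightarrow> int) UNIV UNIV" by (simp add: bij_uminus)
  have "choquet_integral ?d UNIV (\<lambda>y. ennreal_powr (g y) q) = (\<integral>\<^sup>+t\<in>{0<..}. H t \<partial>lborel)"
    by (simp add: choquet_integral_def H_def)
  also have "\<dots> \<le> csum (\<lambda>k. ennreal (c * dy (k + 1) powr ?d) * H (c * dy k powr ?d))"
    by (rule nn_integral_antimono_le_csum[OF anti c d])
  also have "\<dots> = csum (\<lambda>M. ennreal (c * dy (- M + 1) powr ?d) * H (c * dy (- M) powr ?d))"
    by (rule nn_integral_bij_count_space[OF bij, symmetric])
  also have "\<dots> \<le> csum (\<lambda>M. ennreal (c * 2 powr ?d * ?Q * w powr (- p0)) * (ennreal (dy M powr (- \<eta>)) * tail M))"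
  proof (rule csum_mono)
    fix M
    have eq: "c * dy (- M + 1) powr ?d * (?Q * dy M powr (- lam * p0) * s M powr (- p0)) = c * 2 powr ?d * ?Q * w powr (- p0) * dy M powr (- \<eta>)"
    proof -
      have "dy (- M + 1) powr ?d = 2 powr ?d * dy M powr (- ?d)"
      proof -
        have "dy (- M + 1) = 2 * (1 / dy M)" by (simp only: dy_add dy_minus dy_1 mult.commute)
        then show ?thesis by (simp only: powr_mult powr_divide powr_one_eq_one powr_minus_divide)
      qed
      moreover have "s M powr (- p0) = w powr (- p0) * dy M powr (\<delta> * p0 / p)"
        using w by (simp add: powr_mult powr_powr)
      ultimately have "c * dy (- M + 1) powr ?d * (?Q * dy M powr (- lam * p0) * s M powr (- p0))
         = c * 2 powr ?d * ?Q * w powr (- p0) * (dy M powr (- ?d) * dy M powr (- lam * p0) * dy M powr (\<delta> * p0 / p))"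
        by (simp only: mult_ac)
      also have "dy M powr (- ?d) * dy M powr (- lam * p0) * dy M powr (\<delta> * p0 / p) = dy M powr (- \<eta>)"
        by (simp add: powr_add[symmetric] \<eta>_def algebra_simps)
      finally show ?thesis .
    qed
    have "ennreal (c * dy (- M + 1) powr ?d) * H (c * dy (- M) powr ?d)
       \<le> ennreal (c * dy (- M + 1) powr ?d) * (ennreal (?Q * dy M powr (- lam * p0) * s M powr (- p0)) * tail M)"
      by (intro mult_left_mono HM) auto
    also have "\<dots> = ennreal (c * dy (- M + 1) powr ?d * (?Q * dy M powr (- lam * p0) * s M powr (- p0))) * tail M"
      using c by (subst ennreal_mult'[of "c * dy (- M + 1) powr ?d"]) (auto simp: mult.assoc)
    also have "\<dots> = ennreal (c * 2 powr ?d * ?Q * w powr (- p0)) * (ennreal (dy M powr (- \<eta>)) * tail M)"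
      unfolding eq by (subst ennreal_mult'') (auto simp: mult.assoc)
    finally show "ennreal (c * dy (- M + 1) powr ?d) * H (c * dy (- M) powr ?d)
       \<le> ennreal (c * 2 powr ?d * ?Q * w powr (- p0)) * (ennreal (dy M powr (- \<eta>)) * tail M)" .
  qed
  also have "\<dots> \<le> ennreal (c * 2 powr ?d * ?Q * w powr (- p0)) * ennreal (geo \<eta> * w powr p0)"
    unfolding csum_cmult \<eta>_def by (intro mult_left_mono csum_tail_le) auto
  also have "\<dots> = ennreal (c * 2 powr ?d * ?Q * w powr (- p0) * (geo \<eta> * w powr p0))"
    using c Q by (subst ennreal_mult') auto
  also have "c * 2 powr ?d * ?Q * w powr (- p0) * (geo \<eta> * w powr p0) = (C0 * ?K) powr q * 2 powr ?d * ?Q * geo \<eta> * w powr q * (w powr (- p0) * w powr p0)"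
    using C0 K w by (simp add: c_def powr_mult)
  also have "w powr (- p0) * w powr p0 = 1" using w by (simp add: powr_add[symmetric])
  finally show ?thesis by (simp add: \<eta>_def)
qed

end

section \<open>The strong-type inequality\<close>

lemma ennreal_less_powr_iff:
  assumes "0 \<le> v" "0 < q"
  shows "ennreal (v powr q) < ennreal_powr a q \<longleftrightarrow> ennreal v < a"
proof
  assume "ennreal v < a"
  then show "ennreal (v powr q) < ennreal_powr a q"
    using assms by (cases a) (auto simp: ennreal_powr_def ennreal_less_iff intro: powr_less_mono2)
qed (rule less_ennreal_powrD[OF assms])

lemma ennreal_powr_mono:
  assumes "a \<le> b" "0 < q"
  shows "ennreal_powr a q \<le> ennreal_powr b q"
proof (cases b)
  case (real v)
  then obtain u where "a = ennreal u" "0 \<le> u" using assms by (cases a) (auto simp: top_unique)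
  then show ?thesis using real assms by (auto simp: ennreal_powr_def intro!: ennreal_leI powr_mono2)
qed (simp add: ennreal_powr_def)

text \<open>The Choquet integral controls the dyadic sum of the contents of superlevel sets.\<close>

lemma csum_level_content_le:
  fixes f :: "real ^ 'n \<Rightarrow> ennreal"
  assumes p: "0 < p"
  shows "csum (\<lambda>k. ennreal (dy k powr p) * hausdorff_content \<delta> {y. ennreal (dy k) < f y})
    \<le> ennreal (geo p) * choquet_integral \<delta> UNIV (\<lambda>y. ennreal_powr (f y) p)"
proof -
  define H where "H t = hausdorff_content \<delta> {y. ennreal t < ennreal_powr (f y) p}" for t :: real
  have "hausdorff_content \<delta> {y. ennreal (dy k) < f y} = H (dy k powr p)" for k
    using p by (simp add: H_def ennreal_less_powr_iff)
  moreover have "choquet_integral \<delta> UNIV (\<lambda>y. ennreal_powr (f y) p) = (\<integral>\<^sup>+t\<in>{0<..}. H t \<partial>lborel)"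
    by (simp add: choquet_integral_def H_def)
  moreover have "csum (\<lambda>k. ennreal (dy k powr p) * H (dy k powr p)) \<le> ennreal (geo p) * (\<integral>\<^sup>+t\<in>{0<..}. H t \<partial>lborel)"
    using p unfolding H_def
    by (intro csum_le_nn_integral_antimono hausdorff_content_mono) (auto intro: le_less_trans[OF ennreal_leI])
  ultimately show ?thesis by simp
qed

text \<open>Near-optimal covers of all levels at once. The errors \<open>A * 2 powr (- k p) * min (2\<^sup>k) (2 powr - k)\<close> are positive
  even where the content vanishes, and their weighted sum is at most \<open>2 * geo 1 * A\<close>.\<close>

lemma exists_level_covers:
  fixes E :: "int \<Rightarrow> (real ^ 'n) set"
  assumes p: "0 < p" and A: "0 < A" and G: "0 \<le> G"
    and le: "csum (\<lambda>k. ennreal (dy k powr p) * hausdorff_content \<delta> (E k)) \<le> ennreal (G * A)"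
  obtains x :: "int \<Rightarrow> nat \<Rightarrow> real ^ 'n" and r :: "int \<Rightarrow> nat \<Rightarrow> real"
  where "\<forall>k. E k \<subseteq> (\<Union>j. ball (x k j) (r k j))" "\<forall>k j. 0 \<le> r k j"
    "csum (\<lambda>k. ennreal (dy k powr p) * csum (\<lambda>j. ennreal (r k j powr \<delta>))) \<le> ennreal ((G + 2 * geo 1) * A)"
proof -
  define e where "e k = min (dy k) (1 / dy k)" for k
  have e: "0 < e k" for k by (simp add: e_def)
  have "\<exists>(x :: nat \<Rightarrow> real ^ 'n) r. E k \<subseteq> (\<Union>j. ball (x j) (r j)) \<and> (\<forall>j. 0 \<le> r j)
     \<and> csum (\<lambda>j. ennreal (r j powr \<delta>)) < hausdorff_content \<delta> (E k) + ennreal (dy k powr (- p) * (A * e k))" for k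
  proof -
    have "ennreal (dy k powr p) * hausdorff_content \<delta> (E k) < top"
      using csum_ge[of "\<lambda>k. ennreal (dy k powr p) * hausdorff_content \<delta> (E k)" k] le
      by (meson ennreal_less_top le_less_trans order_trans)
    then have "hausdorff_content \<delta> (E k) < top"
      by (auto simp: ennreal_mult_less_top)
    moreover have "0 < ennreal (dy k powr (- p) * (A * e k))" using A e by simp
    ultimately have "hausdorff_content \<delta> (E k) + 0 < hausdorff_content \<delta> (E k) + ennreal (dy k powr (- p) * (A * e k))"
      by (subst ennreal_add_left_cancel_less) auto
    then have "hausdorff_content \<delta> (E k) < hausdorff_content \<delta> (E k) + ennreal (dy k powr (- p) * (A * e k))"
      by (simp only: add_0_right)
    from hausdorff_content_cover[OF this]
    obtain x :: "nat \<Rightarrow> real ^ 'n" and r :: "nat \<Rightarrow> real" where "E k \<subseteq> (\<Union>j. ball (x j) (r j))" "\<forall>j. 0 \<le> r j"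
      "csum (\<lambda>j. ennreal (r j powr \<delta>)) < hausdorff_content \<delta> (E k) + ennreal (dy k powr (- p) * (A * e k))"
      .
    then show ?thesis by blast
  qed
  then have "\<forall>k. \<exists>(x :: nat \<Rightarrow> real ^ 'n) r. E k \<subseteq> (\<Union>j. ball (x j) (r j)) \<and> (\<forall>j. 0 \<le> r j)
     \<and> csum (\<lambda>j. ennreal (r j powr \<delta>)) < hausdorff_content \<delta> (E k) + ennreal (dy k powr (- p) * (A * e k))"
    by (rule allI)
  from choice[OF this] obtain x :: "int \<Rightarrow> nat \<Rightarrow> real ^ 'n" where "\<forall>k. \<exists>r. E k \<subseteq> (\<Union>j. ball (x k j) (r j)) \<and> (\<forall>j. 0 \<le> r j)
     \<and> csum (\<lambda>j. ennreal (r j powr \<delta>)) < hausdorff_content \<delta> (E k) + ennreal (dy k powr (- p) * (A * e k))" ..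
  from choice[OF this] obtain r where xr: "\<forall>k. E k \<subseteq> (\<Union>j. ball (x k j) (r k j)) \<and> (\<forall>j. 0 \<le> r k j)
     \<and> csum (\<lambda>j. ennreal (r k j powr \<delta>)) < hausdorff_content \<delta> (E k) + ennreal (dy k powr (- p) * (A * e k))" ..
  have "csum (\<lambda>k. ennreal (dy k powr p) * csum (\<lambda>j. ennreal (r k j powr \<delta>)))
     \<le> csum (\<lambda>k. ennreal (dy k powr p) * hausdorff_content \<delta> (E k) + ennreal A * ((if dy k \<le> 1 then ennreal (dy k powr 1) else 0) + (if 1 \<le> dy k then ennreal (dy k powr (- 1)) else 0)))"
  proof (rule csum_mono)
    fix k
    have "ennreal (dy k powr p) * csum (\<lambda>j. ennreal (r k j powr \<delta>))
      \<le> ennreal (dy k powr p) * (hausdorff_content \<delta> (E k) + ennreal (dy k powr (- p) * (A * e k)))"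
      using xr by (intro mult_left_mono) (auto intro: less_imp_le)
    also have "\<dots> = ennreal (dy k powr p) * hausdorff_content \<delta> (E k) + ennreal (dy k powr p * (dy k powr (- p) * (A * e k)))"
      using A e[of k] by (simp add: distrib_left ennreal_mult'[symmetric])
    also have "dy k powr p * (dy k powr (- p) * (A * e k)) = (dy k powr p * dy k powr (- p)) * (A * e k)" by simp
    also have "dy k powr p * dy k powr (- p) = 1" by (simp add: powr_add[symmetric])
    also have "ennreal (1 * (A * e k)) = ennreal A * ennreal (e k)" using A e[of k] by (simp add: ennreal_mult)
    also have "ennreal (e k) \<le> (if dy k \<le> 1 then ennreal (dy k powr 1) else 0) + (if 1 \<le> dy k then ennreal (dy k powr (- 1)) else 0)"
    proof (cases "dy k \<le> 1")
      case True
      have "ennreal (e k) \<le> ennreal (dy k powr 1)" by (intro ennreal_leI) (simp add: e_def)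
      then have "ennreal (e k) \<le> (if dy k \<le> 1 then ennreal (dy k powr 1) else 0)" using True by simp
      then show ?thesis by (rule add_increasing2[OF zero_le])
    next
      case False
      have "ennreal (e k) \<le> ennreal (dy k powr (- 1))" by (intro ennreal_leI) (simp add: e_def powr_minus_divide)
      then show ?thesis using False by simp
    qed
    finally show "ennreal (dy k powr p) * csum (\<lambda>j. ennreal (r k j powr \<delta>))
     \<le> ennreal (dy k powr p) * hausdorff_content \<delta> (E k) + ennreal A * ((if dy k \<le> 1 then ennreal (dy k powr 1) else 0) + (if 1 \<le> dy k then ennreal (dy k powr (- 1)) else 0))"
      by (simp add: mult_left_mono add_left_mono)
  qed
  also have "\<dots> \<le> ennreal (G * A) + ennreal A * (ennreal (geo 1 * 1 powr 1) + ennreal (geo 1 * 1 powr (- 1)))"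
    unfolding csum_add csum_cmult by (intro add_mono mult_left_mono csum_dy_le csum_dy_ge le) auto
  also have "\<dots> = ennreal ((G + 2 * geo 1) * A)"
  proof -
    have g: "0 < geo 1" by (rule geo_pos) simp
    have "ennreal A * (ennreal (geo 1 * 1 powr 1) + ennreal (geo 1 * 1 powr (- 1))) = ennreal A * ennreal (2 * geo 1)"
      using g by (subst ennreal_plus[symmetric]) auto
    also have "\<dots> = ennreal (2 * geo 1 * A)" using A g by (simp add: ennreal_mult mult.commute)
    finally have "ennreal (G * A) + ennreal A * (ennreal (geo 1 * 1 powr 1) + ennreal (geo 1 * 1 powr (- 1))) = ennreal (G * A) + ennreal (2 * geo 1 * A)"
      by simp
    also have "\<dots> = ennreal (G * A + 2 * geo 1 * A)" using A G g by (subst ennreal_plus) auto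
    finally show ?thesis by (simp add: distrib_right)
  qed
  finally show ?thesis using xr by (intro that[of x r]) auto
qed

text \<open>Reduction to strict upper bounds \<open>A\<close> of the integral, which may be taken positive even if the
  integral vanishes.\<close>

lemma le_powr_limit:
  fixes X F :: ennreal
  assumes c: "0 < c" and p: "0 < p" and le: "\<And>A. 0 < A \<Longrightarrow> F < ennreal A \<Longrightarrow> X \<le> ennreal (c * A powr (1 / p))"
  shows "X \<le> ennreal c * ennreal_powr F (1 / p)"
proof (cases F)
  case top
  then show ?thesis using c by (simp add: ennreal_powr_def ennreal_mult_top)
next
  case (real a)
  have "X \<le> ennreal (c * (a + 1) powr (1 / p))" using real by (intro le) (auto simp: ennreal_less_iff)
  then obtain z where z: "X = ennreal z" "0 \<le> z"
    by (cases X) (auto simp: top_unique)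
  have "(z / c) powr p \<le> a"
  proof (rule dense_ge)
    fix A assume "a < A"
    then have A: "0 < A" "F < ennreal A" using real by (auto simp: ennreal_less_iff)
    then have "z \<le> c * A powr (1 / p)" using le[OF A] z c by (simp add: ennreal_le_iff)
    then have "z / c \<le> A powr (1 / p)" using c by (simp add: field_simps)
    then have "(z / c) powr p \<le> (A powr (1 / p)) powr p" using z c p by (intro powr_mono2) auto
    then show "(z / c) powr p \<le> A" using A p by (simp add: powr_powr)
  qed
  then have "((z / c) powr p) powr (1 / p) \<le> a powr (1 / p)" using p by (intro powr_mono2) auto
  then have "z / c \<le> a powr (1 / p)" using z c p by (simp add: powr_powr)
  then have "z \<le> c * a powr (1 / p)" using c by (simp add: field_simps)
  then have "X \<le> ennreal (c * a powr (1 / p))" using z by (simp add: ennreal_leI)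
  also have "\<dots> = ennreal c * ennreal_powr F (1 / p)"
    using real c by (simp add: ennreal_powr_def ennreal_mult)
  finally show ?thesis .
qed

theorem theorem5p9:
  fixes \<delta> \<alpha> \<kappa> p :: real
  assumes "0 < \<delta>" and "\<delta> \<le> real CARD('n::finite)"
    and "0 < \<alpha>" and "\<alpha> < \<delta>"
    and "0 \<le> \<kappa>" and "\<kappa> < \<alpha>"
    and "\<delta> / real CARD('n) < p" and "p < \<delta> / \<alpha>"
  shows "\<exists>c::real. 0 < c \<and>
    (\<forall>f :: real ^ 'n \<Rightarrow> ereal. f \<in> borel_measurable lebesgue \<longrightarrow>
      ennreal_powr
        (choquet_integral (\<delta> - \<kappa> * p) UNIV
          (\<lambda>x. ennreal_powr (riesz_potential (real CARD('n)) \<alpha> f x)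
                 (p * (\<delta> - \<kappa> * p) / (\<delta> - p * \<alpha>))))
        ((\<delta> - p * \<alpha>) / (p * (\<delta> - \<kappa> * p)))
      \<le> ennreal c *
        ennreal_powr
          (choquet_integral \<delta> UNIV (\<lambda>x. ennreal_powr (e2ennreal \<bar>f x\<bar>) p))
          (1 / p))"
proof -
  let ?n = "real CARD('n)"
  have "0 < \<delta> / ?n" using assms(1) by (intro divide_pos_pos) auto
  then have p: "0 < p" using assms(7) by linarith
  have pa: "p * \<alpha> < \<delta>" using assms(3,8) by (simp add: field_simps)
  have kp: "\<kappa> * p < \<alpha> * p" using assms(6) p by simp
  \<comment> \<open>an exponent \<open>p0 < p\<close> with \<open>p0 > \<delta> / n\<close> and \<open>\<kappa> p / p0 < \<alpha>\<close>\<close>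
  have "max (\<delta> / ?n) (\<kappa> * p / \<alpha>) < p" using assms(3,7) kp by (simp add: field_simps)
  then obtain p0 where p0: "max (\<delta> / ?n) (\<kappa> * p / \<alpha>) < p0" "p0 < p" using dense by blast
  then have p0': "0 < p0" using \<open>0 < \<delta> / ?n\<close> by simp
  define lam where "lam = \<kappa> * p / p0"
  have lp: "lam * p0 = \<kappa> * p" using p0' by (simp add: lam_def)
  have lam: "0 \<le> lam" "lam < \<alpha>"
    using p0 p0' p assms(3,5) by (auto simp: lam_def field_simps)
  define d where "d = \<delta> - \<kappa> * p"
  have d: "0 < d" using kp pa by (simp add: d_def mult.commute)
  define q where "q = p * d / (\<delta> - p * \<alpha>)"
  have q: "0 < q" using p d pa by (simp add: q_def)
  have qd: "q = (\<delta> - lam * p0) / (\<delta> / p - \<alpha>)"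
    using p pa by (simp add: q_def d_def lp field_simps)
  have q1: "(\<delta> - p * \<alpha>) / (p * d) = 1 / q" by (simp add: q_def)
  define C0 where "C0 = 8 * (6 ^ CARD('n) / uball TYPE('n)) * 2 powr (?n - \<alpha>)"
  have C0: "0 < C0" by (simp add: C0_def)
  define C1 where "C1 = (C0 * scale_const ?n \<delta> \<alpha> lam p) powr q * 2 powr d * content_const ?n \<delta> lam p0 * geo (\<delta> * (1 - p0 / p))"
  define G where "G = geo p + 2 * geo 1"
  have gpos: "0 < geo p" "0 < geo 1" using p by (auto intro: geo_pos)
  then have G: "0 < G" by (simp add: G_def)
  \<comment> \<open>\<open>max C1 1\<close> only makes positivity of \<open>c\<close> evident\<close>
  define c where "c = (max C1 1) powr (1 / q) * G powr (1 / p)"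
  have c: "0 < c" using G by (simp add: c_def)
  have main: "ennreal_powr (choquet_integral d UNIV (\<lambda>x. ennreal_powr (riesz_potential ?n \<alpha> f x) q)) (1 / q)
      \<le> ennreal c * ennreal_powr (choquet_integral \<delta> UNIV (\<lambda>x. ennreal_powr (e2ennreal \<bar>f x\<bar>) p)) (1 / p)"
    if f: "f \<in> borel_measurable lebesgue" for f :: "real ^ 'n \<Rightarrow> ereal"
  proof (rule le_powr_limit[OF c p])
    fix A :: real
    assume A: "0 < A" and less: "choquet_integral \<delta> UNIV (\<lambda>x. ennreal_powr (e2ennreal \<bar>f x\<bar>) p) < ennreal A"
    define E where "E k = {y. ennreal (dy k) < e2ennreal \<bar>f y\<bar>}" for k
    have "csum (\<lambda>k. ennreal (dy k powr p) * hausdorff_content \<delta> (E k)) \<le> ennreal (geo p) * ennreal A"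
      unfolding E_def by (rule order_trans[OF csum_level_content_le[OF p]]) (intro mult_left_mono less_imp_le[OF less], simp)
    also have "\<dots> = ennreal (geo p * A)" using gpos A by (simp add: ennreal_mult)
    finally have le: "csum (\<lambda>k. ennreal (dy k powr p) * hausdorff_content \<delta> (E k)) \<le> ennreal (geo p * A)" .
    obtain x :: "int \<Rightarrow> nat \<Rightarrow> real ^ 'n" and r :: "int \<Rightarrow> nat \<Rightarrow> real" where xr:
      "\<forall>k. E k \<subseteq> (\<Union>j. ball (x k j) (r k j))" "\<forall>k j. 0 \<le> r k j"
      "csum (\<lambda>k. ennreal (dy k powr p) * csum (\<lambda>j. ennreal (r k j powr \<delta>))) \<le> ennreal (G * A)"
      unfolding G_def by (rule exists_level_covers[OF p A less_imp_le[OF gpos(1)] le])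
    define w where "w = (G * A) powr (1 / p)"
    have w: "0 < w" "w powr p = G * A" using G A p by (auto simp: w_def powr_powr)
    interpret level_covers \<delta> \<alpha> lam p p0 w E x r
      by unfold_locales (use assms p0 lam w xr in auto)
    have le: "riesz_potential ?n \<alpha> f y \<le> ennreal C0 * potential y" for y
      using riesz_potential_le[OF f, of \<alpha> y] assms unfolding C0_def potential_def mass_def E_def by simp
    have "choquet_integral d UNIV (\<lambda>x. ennreal_powr (riesz_potential ?n \<alpha> f x) q) \<le> ennreal (C1 * w powr q)"
      using choquet_integral_le[OF C0 le _ qd] d unfolding C1_def d_def lp by simp
    also have "\<dots> \<le> ennreal (max C1 1 * w powr q)" by (intro ennreal_leI mult_right_mono) auto
    finally have "ennreal_powr (choquet_integral d UNIV (\<lambda>x. ennreal_powr (riesz_potential ?n \<alpha> f x) q)) (1 / q)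
       \<le> ennreal_powr (ennreal (max C1 1 * w powr q)) (1 / q)"
      using q by (intro ennreal_powr_mono) auto
    also have "\<dots> = ennreal ((max C1 1 * w powr q) powr (1 / q))"
      by (simp add: ennreal_powr_def)
    also have "(max C1 1 * w powr q) powr (1 / q) = max C1 1 powr (1 / q) * w"
      using q w by (simp add: powr_mult powr_powr)
    also have "w = G powr (1 / p) * A powr (1 / p)" by (simp add: w_def powr_mult)
    finally show "ennreal_powr (choquet_integral d UNIV (\<lambda>x. ennreal_powr (riesz_potential ?n \<alpha> f x) q)) (1 / q) \<le> ennreal (c * A powr (1 / p))"
      by (simp add: c_def mult.assoc)
  qed
  then show ?thesis using c unfolding d_def[symmetric] q1 q_def[symmetric] by blast
qed

end
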